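(* There is a randomized algorithm that, given any $n$-vertex graph $G$ with maximum degree $\Delta$ via adjacency list and adjacency matrix access, outputs a proper $(\Delta+1)$ vertex coloring of $G$ in $O(n\sqrt{n\log n})$ expected time.
   Context: A proper $(\Delta+1)$ vertex coloring assigns each vertex a color in $\{1,\dots,\Delta+1\}$ with no monochromatic edge. Adjacency list access allows degree queries and neighbor queries (the $i$-th neighbor of a vertex); adjacency matrix access allows pair queries (whether $(u,v)$ is an edge); each query costs unit time. *)

theory Defs
  imports "HOL-Probability.SPMF" "HOL-Library.Landau_Symbols"
begin

text \<open>
  Finite simple graphs on the vertex set \<open>{..<n}\<close>, together with the (arbitrary) order in which
  the adjacency list of each vertex presents its neighbours.
\<close>

record graph =
  nverts :: nat
  edges :: "nat set set"
  adj_list :: "nat \<Rightarrow> nat list"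

definition nbrs :: "graph \<Rightarrow> nat \<Rightarrow> nat set" where
  "nbrs G v = {u. {u, v} \<in> edges G}"

definition valid_graph :: "graph \<Rightarrow> bool" where
  "valid_graph G \<longleftrightarrow>
     (\<forall>e \<in> edges G. \<exists>u v. e = {u, v} \<and> u \<noteq> v \<and> u < nverts G \<and> v < nverts G) \<and>
     (\<forall>v < nverts G. distinct (adj_list G v) \<and> set (adj_list G v) = nbrs G v)"

definition degree :: "graph \<Rightarrow> nat \<Rightarrow> nat" where
  "degree G v = card (nbrs G v)"

text \<open>The inserted 0 only matters for the graph without vertices.\<close>

definition max_degree :: "graph \<Rightarrow> nat" where
  "max_degree G = Max (insert 0 (degree G ` {..<nverts G}))"

definition proper_coloring :: "graph \<Rightarrow> nat \<Rightarrow> (nat \<Rightarrow> nat) \<Rightarrow> bool" where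
  "proper_coloring G q col \<longleftrightarrow>
     (\<forall>v < nverts G. col v \<in> {1..q}) \<and>
     (\<forall>u v. {u, v} \<in> edges G \<longrightarrow> col u \<noteq> col v)"

text \<open>
  The model of computation is a randomized word RAM, programmed in a while-language over
  word-valued variables and word-indexed, zero-initialised arrays of words.  The graph is accessible
  only through the three query expressions \<open>Deg\<close> (degree), \<open>Nbr\<close> (the \<open>i\<close>-th neighbour,
  counting from 0) and \<open>Adj\<close> (pair query).
\<close>

type_synonym name = string

datatype aexp =
    Const nat
  | Var name
  | Read name aexp
  | Plus aexp aexp
  | Minus aexp aexp
  | Times aexp aexp
  | Div aexp aexp
  | Mod aexp aexp
  | Deg aexp
  | Nbr aexp aexp
  | Adj aexp aexp

datatype bexp =
    Less aexp aexp
  | Eq aexp aexp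
  | Neg bexp
  | Conj bexp bexp

datatype com =
    Skip
  | Assign name aexp
  | Store name aexp aexp
  | Rand name aexp
  | Seq com com
  | Cond bexp com com
  | While bexp com

record state =
  vars :: "name \<Rightarrow> nat"
  arrs :: "name \<Rightarrow> nat \<Rightarrow> nat"

text \<open>
  Words have \<open>k \<sqdot> \<lceil>log 2 (n + 2)\<rceil>\<close> bits for a constant \<open>k\<close>; below, \<open>W\<close> is the number
  of different words.
\<close>

definition word_count :: "nat \<Rightarrow> nat \<Rightarrow> nat" where
  "word_count k n = 2 ^ (k * nat \<lceil>log 2 (real n + 2)\<rceil>)"

text \<open>
  Subtraction is truncated at 0, and invalid degree and neighbour queries are answered by 0.
\<close>

primrec aval :: "nat \<Rightarrow> graph \<Rightarrow> aexp \<Rightarrow> state \<Rightarrow> nat" where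
  "aval W G (Const c) s = c mod W"
| "aval W G (Var x) s = vars s x"
| "aval W G (Read a e) s = arrs s a (aval W G e s)"
| "aval W G (Plus e f) s = (aval W G e s + aval W G f s) mod W"
| "aval W G (Minus e f) s = aval W G e s - aval W G f s"
| "aval W G (Times e f) s = (aval W G e s * aval W G f s) mod W"
| "aval W G (Div e f) s = aval W G e s div aval W G f s"
| "aval W G (Mod e f) s = aval W G e s mod aval W G f s"
| "aval W G (Deg e) s =
     (let v = aval W G e s in if v < nverts G then length (adj_list G v) else 0)"
| "aval W G (Nbr e f) s =
     (let v = aval W G e s; i = aval W G f s
      in if v < nverts G \<and> i < length (adj_list G v) then adj_list G v ! i else 0)"
| "aval W G (Adj e f) s = (if {aval W G e s, aval W G f s} \<in> edges G then 1 else 0)"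

primrec bval :: "nat \<Rightarrow> graph \<Rightarrow> bexp \<Rightarrow> state \<Rightarrow> bool" where
  "bval W G (Less e f) s \<longleftrightarrow> aval W G e s < aval W G f s"
| "bval W G (Eq e f) s \<longleftrightarrow> aval W G e s = aval W G f s"
| "bval W G (Neg b) s \<longleftrightarrow> \<not> bval W G b s"
| "bval W G (Conj b c) s \<longleftrightarrow> bval W G b s \<and> bval W G c s"

text \<open>
  Every memory access, arithmetic or Boolean operation and query takes one unit of time.
\<close>

primrec acost :: "aexp \<Rightarrow> nat" where
  "acost (Const c) = 1"
| "acost (Var x) = 1"
| "acost (Read a e) = 1 + acost e"
| "acost (Plus e f) = 1 + acost e + acost f"
| "acost (Minus e f) = 1 + acost e + acost f"
| "acost (Times e f) = 1 + acost e + acost f"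
| "acost (Div e f) = 1 + acost e + acost f"
| "acost (Mod e f) = 1 + acost e + acost f"
| "acost (Deg e) = 1 + acost e"
| "acost (Nbr e f) = 1 + acost e + acost f"
| "acost (Adj e f) = 1 + acost e + acost f"

primrec bcost :: "bexp \<Rightarrow> nat" where
  "bcost (Less e f) = 1 + acost e + acost f"
| "bcost (Eq e f) = 1 + acost e + acost f"
| "bcost (Neg b) = 1 + bcost b"
| "bcost (Conj b c) = 1 + bcost b + bcost c"

text \<open>
  The semantics of a program is the subprobability distribution of the pair of final state and
  running time; the missing mass is the probability of nontermination.
\<close>

definition tick :: "nat \<Rightarrow> (state \<times> nat) spmf \<Rightarrow> (state \<times> nat) spmf" where
  "tick c = map_spmf (\<lambda>(s, t). (s, c + t))"

lemma tick_mono [partial_function_mono]: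
  "mono_spmf B \<Longrightarrow> mono_spmf (\<lambda>g. tick c (B g))"
  unfolding tick_def by (rule map_spmf_mono)

partial_function (spmf) loop ::
  "(state \<Rightarrow> bool) \<Rightarrow> nat \<Rightarrow> (state \<Rightarrow> (state \<times> nat) spmf) \<Rightarrow> state \<Rightarrow> (state \<times> nat) spmf"
where
  "loop b c body s =
     (if b s then tick c (bind_spmf (body s) (\<lambda>(s', t). tick t (loop b c body s')))
      else return_spmf (s, c))"

text \<open>
  \<open>Rand x e\<close> draws a uniformly random element of \<open>{..<m}\<close>, where \<open>m\<close> is the value of \<open>e\<close>
  (and yields 0 if \<open>m = 0\<close>).
\<close>

primrec exec :: "nat \<Rightarrow> graph \<Rightarrow> com \<Rightarrow> state \<Rightarrow> (state \<times> nat) spmf" where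
  "exec W G Skip s = return_spmf (s, 1)"
| "exec W G (Assign x e) s =
     return_spmf (s\<lparr>vars := (vars s)(x := aval W G e s)\<rparr>, 1 + acost e)"
| "exec W G (Store a e f) s =
     return_spmf
       (s\<lparr>arrs := (arrs s)(a := (arrs s a)(aval W G e s := aval W G f s))\<rparr>, 1 + acost e + acost f)"
| "exec W G (Rand x e) s =
     map_spmf (\<lambda>r. (s\<lparr>vars := (vars s)(x := r)\<rparr>, 1 + acost e))
       (spmf_of_set {..<max 1 (aval W G e s)})"
| "exec W G (Seq p q) s =
     bind_spmf (exec W G p s) (\<lambda>(s', t). tick t (exec W G q s'))"
| "exec W G (Cond b p q) s =
     tick (1 + bcost b) (if bval W G b s then exec W G p s else exec W G q s)"
| "exec W G (While b p) s = loop (bval W G b) (1 + bcost b) (exec W G p) s"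

definition init_state :: "graph \<Rightarrow> state" where
  "init_state G = \<lparr>vars = (\<lambda>_. 0)(''n'' := nverts G), arrs = (\<lambda>_ _. 0)\<rparr>"

text \<open>The output is the content of the array \<open>color\<close> on termination.\<close>

definition run :: "nat \<Rightarrow> com \<Rightarrow> graph \<Rightarrow> ((nat \<Rightarrow> nat) \<times> nat) spmf" where
  "run k P G =
     map_spmf (\<lambda>(s, t). (arrs s ''color'', t))
       (exec (word_count k (nverts G)) G P (init_state G))"

definition expected_time :: "nat \<Rightarrow> com \<Rightarrow> graph \<Rightarrow> ennreal" where
  "expected_time k P G =
     (\<integral>\<^sup>+ r. (case r of None \<Rightarrow> \<infinity> | Some (out, t) \<Rightarrow> of_nat t) \<partial>measure_pmf (run k P G))"

end

theory Submission
  imports Defs "HOL-Real_Asymp.Real_Asymp"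
begin

text \<open>
  If \<open>\<Delta>\<^sup>2 < n log n\<close>, the sequential greedy algorithm takes time \<open>O(n \<Delta>) = O(n \<surd>(n log n))\<close>.

  Otherwise colour the vertices in uniformly random order.  For a vertex \<open>v\<close>, draw uniformly random
  colours until one is free at \<open>v\<close>, testing a colour \<open>c\<close> by pair queries between \<open>v\<close> and all
  vertices of the current colour class of \<open>c\<close>.  The class of a random colour has at most
  \<open>n / (\<Delta> + 1)\<close> vertices on average, and \<open>(\<Delta> + 1) / a\<close> draws are expected if \<open>a\<close> colours are free, so
  \<open>v\<close> costs \<open>O(n / a)\<close>.  Here \<open>a \<ge> 1 + (\<Delta> - deg v) + Y\<close>, where \<open>Y\<close> is the number of neighbours
  that come after \<open>v\<close>; it is uniform on \<open>{0..deg v}\<close>, so the mean of \<open>1 / a\<close> is at most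
  \<open>H(\<Delta> + 1) / (\<Delta> + 1)\<close>.  The total is \<open>O(n\<^sup>2 log n / \<Delta>) = O(n \<surd>(n log n))\<close>.

  Instead of reasoning about random permutations, the expected remaining cost is carried as a
  potential of the set of uncoloured vertices, which is exactly balanced by one random step.
\<close>

subsection \<open>Expected running times\<close>

text \<open>Expected running time as a backward transformer: \<open>\<phi>\<close> is the cost still
  to be paid in the final state, and \<open>None\<close>, which stands for nontermination, costs
  infinity.\<close>

definition expect :: "(state \<times> nat) spmf \<Rightarrow> (state \<Rightarrow> ennreal) \<Rightarrow> ennreal" where
  "expect p \<phi> =
     (\<integral>\<^sup>+ r. (case r of None \<Rightarrow> \<infinity> | Some (s, t) \<Rightarrow> of_nat t + \<phi> s) \<partial>measure_pmf p)"

lemma expect_return [simp]: "expect (return_spmf (s, t)) \<phi> = of_nat t + \<phi> s"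
  by (simp add: expect_def)

lemma expect_tick [simp]: "expect (tick c p) \<phi> = of_nat c + expect p \<phi>"
proof -
  have "expect (tick c p) \<phi> = (\<integral>\<^sup>+ r. of_nat c +
      (case r of None \<Rightarrow> \<infinity> | Some (s, t) \<Rightarrow> of_nat t + \<phi> s) \<partial>measure_pmf p)"
    unfolding expect_def tick_def
    by (auto intro!: nn_integral_cong split: option.splits simp: add.assoc)
  also have "\<dots> = of_nat c + expect p \<phi>"
    unfolding expect_def by (subst nn_integral_add) auto
  finally show ?thesis .
qed

text \<open>Conditioning on the outcome of \<open>p\<close>: the expected cost of the continuation
  becomes the final charge of \<open>p\<close>. This has the shape of \<open>Seq\<close> in
  \<open>exec\<close>.\<close>

lemma expect_bind_tick:
  "expect (bind_spmf p (\<lambda>(s, t). tick t (q s))) \<phi> = expect p (\<lambda>s. expect (q s) \<phi>)"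
proof -
  have "expect (bind_spmf p (\<lambda>(s, t). tick t (q s))) \<phi> =
      (\<integral>\<^sup>+ r. expect (case r of None \<Rightarrow> return_pmf None | Some (s, t) \<Rightarrow> tick t (q s)) \<phi>
        \<partial>measure_pmf p)"
    unfolding bind_spmf_def expect_def by (auto intro!: nn_integral_cong split: option.splits)
  also have "\<dots> = expect p (\<lambda>s. expect (q s) \<phi>)"
    unfolding expect_def[of p]
    by (auto intro!: nn_integral_cong split: option.splits) (simp add: expect_def)
  finally show ?thesis .
qed

lemma expect_mono: "(\<And>s. \<phi> s \<le> \<psi> s) \<Longrightarrow> expect p \<phi> \<le> expect p \<psi>"
  unfolding expect_def
  by (intro nn_integral_mono) (auto split: option.splits intro!: add_left_mono)

text \<open>A function with finite integral is finite almost everywhere, and for a pmf this means on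
  the whole support. Charges of infinity therefore mark outcomes that cannot occur.\<close>

lemma expect_finite:
  assumes "expect p \<phi> < \<infinity>"
  shows "lossless_spmf p" and "(s, t) \<in> set_spmf p \<Longrightarrow> \<phi> s \<noteq> \<infinity>"
proof -
  have "AE r in measure_pmf p. (case r of None \<Rightarrow> \<infinity> | Some (s, t) \<Rightarrow> of_nat t + \<phi> s) \<noteq> \<infinity>"
    by (rule nn_integral_PInf_AE[OF _ less_imp_neq[OF assms[unfolded expect_def]]]) simp
  then have *: "\<And>r. r \<in> set_pmf p \<Longrightarrow>
      (case r of None \<Rightarrow> \<infinity> | Some (s, t) \<Rightarrow> of_nat t + \<phi> s) \<noteq> \<infinity>"
    by (simp add: AE_measure_pmf_iff)
  show "lossless_spmf p"
    using *[of None] by (auto simp: lossless_iff_set_pmf_None)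
  show "\<phi> s \<noteq> \<infinity>" if "(s, t) \<in> set_spmf p"
    using *[of "Some (s, t)"] that by (auto simp: in_set_spmf)
qed

text \<open>
  Charging \<open>k\<close> for a run that is unfinished after \<open>k\<close> rounds makes every superinvariant \<open>I\<close> an upper bound; in the limit nontermination is charged \<open>\<infinity>\<close>, so a finite
  \<open>I\<close> proves almost sure termination as well.
\<close>

primrec loop_upto :: "(state \<Rightarrow> bool) \<Rightarrow> nat \<Rightarrow> (state \<Rightarrow> (state \<times> nat) spmf) \<Rightarrow> nat \<Rightarrow>
    state \<Rightarrow> (state \<times> nat) spmf" where
  "loop_upto b c body 0 s = return_pmf None"
| "loop_upto b c body (Suc k) s =
     (if b s then tick c (bind_spmf (body s) (\<lambda>(s', t). tick t (loop_upto b c body k s')))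
      else return_spmf (s, c))"

lemma ord_spmf_tick: "ord_spmf (=) p q \<Longrightarrow> ord_spmf (=) (tick c p) (tick c q)"
  unfolding tick_def map_spmf_conv_bind_spmf by (rule bind_spmf_mono') auto

text \<open>Truncated unrollings lie below the fixed point: one unfolding of \<open>loop\<close> per
  induction step, then monotonicity of bind.\<close>

lemma loop_upto_le_loop: "ord_spmf (=) (loop_upto b c body k s) (loop b c body s)"
proof (induction k arbitrary: s)
  case (Suc k)
  show ?case
    by (subst loop.simps)
      (auto intro!: ord_spmf_tick bind_spmf_mono' Suc.IH simp: case_prod_beta)
qed simp

lemma loop_upto_charge:
  assumes c: "1 \<le> c"
    and step: "\<And>s. b s \<Longrightarrow> of_nat c + expect (body s) I \<le> I s"
    and exit: "\<And>s. \<not> b s \<Longrightarrow> of_nat c + \<phi> s \<le> I s"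
  shows "(\<integral>\<^sup>+ r. (case r of None \<Rightarrow> of_nat k | Some (s, t) \<Rightarrow> of_nat t + \<phi> s)
    \<partial>measure_pmf (loop_upto b c body k s)) \<le> I s"
proof (induction k arbitrary: s)
  case (Suc k)
  let ?f = "\<lambda>k r. (case r of None \<Rightarrow> of_nat k | Some (s, t) \<Rightarrow> of_nat t + \<phi> s) :: ennreal"
  \<comment> \<open>A round costs at least \<open>c \<ge> 1\<close>, which pays for raising the
    charge of an unfinished run from \<open>k\<close> to \<open>k + 1\<close>.\<close>
  have tick: "(\<integral>\<^sup>+ r. ?f (Suc k) r \<partial>measure_pmf (tick (c + t) (loop_upto b c body k s'))) \<le>
      of_nat c + (of_nat t + I s')" for s' t
  proof -
    have "(\<integral>\<^sup>+ r. ?f (Suc k) r \<partial>measure_pmf (tick (c + t) (loop_upto b c body k s'))) \<le>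
        (\<integral>\<^sup>+ r. of_nat (c + t) + ?f k r \<partial>measure_pmf (loop_upto b c body k s'))"
      unfolding tick_def using c
      by (auto intro!: nn_integral_mono split: option.splits simp: add.assoc
          simp flip: of_nat_Suc of_nat_add)
    also have "\<dots> = of_nat (c + t) + (\<integral>\<^sup>+ r. ?f k r \<partial>measure_pmf (loop_upto b c body k s'))"
      by (subst nn_integral_add) auto
    also have "\<dots> \<le> of_nat (c + t) + I s'"
      by (intro add_left_mono Suc.IH)
    finally show ?thesis by (simp add: add.assoc)
  qed
  show ?case
  proof (cases "b s")
    case True
    have "(\<integral>\<^sup>+ r. ?f (Suc k) r \<partial>measure_pmf (loop_upto b c body (Suc k) s)) =
        (\<integral>\<^sup>+ r. ?f (Suc k) r \<partial>measure_pmf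
          (bind_spmf (body s) (\<lambda>(s', t). tick (c + t) (loop_upto b c body k s'))))"
      using True
      by (simp add: tick_def map_spmf_bind_spmf o_def case_prod_unfold spmf.map_comp add.assoc)
    also have "\<dots> = (\<integral>\<^sup>+ r. (case r of None \<Rightarrow> of_nat (Suc k) | Some (s', t) \<Rightarrow>
          (\<integral>\<^sup>+ r. ?f (Suc k) r \<partial>measure_pmf (tick (c + t) (loop_upto b c body k s'))))
        \<partial>measure_pmf (body s))"
      unfolding bind_spmf_def nn_integral_bind_pmf
      by (auto intro!: nn_integral_cong split: option.splits)
    also have "\<dots> \<le> (\<integral>\<^sup>+ r. of_nat c + (case r of None \<Rightarrow> \<infinity> | Some (s', t) \<Rightarrow> of_nat t + I s')
        \<partial>measure_pmf (body s))"
      using tick by (intro nn_integral_mono) (auto split: option.splits)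
    also have "\<dots> = of_nat c + expect (body s) I"
      unfolding expect_def by (subst nn_integral_add) auto
    also have "\<dots> \<le> I s" using step[OF True] .
    finally show ?thesis .
  qed (use exit in auto)
qed auto

text \<open>Park induction for expected time. The cost of the full loop, capped at \<open>m\<close>,
  is compared with that of \<open>m\<close> unrolled rounds; monotone convergence in
  \<open>m\<close> then removes the cap and restores the value infinity at
  \<open>None\<close>.\<close>

lemma expect_loop_le:
  assumes "1 \<le> c"
    and "\<And>s. b s \<Longrightarrow> of_nat c + expect (body s) I \<le> I s"
    and "\<And>s. \<not> b s \<Longrightarrow> of_nat c + \<phi> s \<le> I s"
  shows "expect (loop b c body s) \<phi> \<le> I s"
proof -
  define f :: "nat \<Rightarrow> (state \<times> nat) option \<Rightarrow> ennreal" where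
    "f m r = min (of_nat m) (case r of None \<Rightarrow> \<infinity> | Some (s, t) \<Rightarrow> of_nat t + \<phi> s)" for m r
  have bound: "(\<integral>\<^sup>+ r. f m r \<partial>measure_pmf (loop b c body s)) \<le> I s" for m
  proof -
    \<comment> \<open>The order on spmfs supplies a coupling: a truncated run that stops agrees with
      the full run, and one that does not is charged \<open>m\<close>, the value of the cap.\<close>
    obtain pq where pq: "\<And>x y. (x, y) \<in> set_pmf pq \<Longrightarrow> ord_option (=) x y"
        "map_pmf fst pq = loop_upto b c body m s" "map_pmf snd pq = loop b c body s"
      using loop_upto_le_loop[of b c body m s] by (elim rel_pmf.cases) blast
    have "(\<integral>\<^sup>+ r. f m r \<partial>measure_pmf (loop b c body s)) =
        (\<integral>\<^sup>+ xy. f m (snd xy) \<partial>measure_pmf pq)"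
      by (simp flip: pq(3))
    also have "\<dots> \<le> (\<integral>\<^sup>+ xy. (case fst xy of None \<Rightarrow> of_nat m | Some (s, t) \<Rightarrow> of_nat t + \<phi> s)
        \<partial>measure_pmf pq)"
    proof (intro nn_integral_mono_AE, unfold AE_measure_pmf_iff, safe)
      fix x y assume "(x, y) \<in> set_pmf pq"
      from pq(1)[OF this]
      show "f m (snd (x, y)) \<le>
          (case fst (x, y) of None \<Rightarrow> of_nat m | Some (s, t) \<Rightarrow> of_nat t + \<phi> s)"
        by (cases x; cases y) (auto simp: f_def)
    qed
    also have "\<dots> = (\<integral>\<^sup>+ r. (case r of None \<Rightarrow> of_nat m | Some (s, t) \<Rightarrow> of_nat t + \<phi> s)
        \<partial>measure_pmf (loop_upto b c body m s))"
      by (simp flip: pq(2))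
    also have "\<dots> \<le> I s" using assms by (rule loop_upto_charge)
    finally show ?thesis .
  qed
  have "(SUP m. f m r) = (case r of None \<Rightarrow> \<infinity> | Some (s, t) \<Rightarrow> of_nat t + \<phi> s)" for r
    unfolding f_def by (subst inf_min[symmetric], subst SUP_inf[symmetric])
      (auto simp: ennreal_SUP_of_nat_eq_top)
  then have "expect (loop b c body s) \<phi> =
      (\<integral>\<^sup>+ r. (SUP m. f m r) \<partial>measure_pmf (loop b c body s))"
    by (simp add: expect_def)
  also have "\<dots> = (SUP m. \<integral>\<^sup>+ r. f m r \<partial>measure_pmf (loop b c body s))"
    by (rule nn_integral_monotone_convergence_SUP)
      (auto simp: incseq_def le_fun_def f_def min_le_iff_disj intro!: min.mono)
  also have "\<dots> \<le> I s" using bound by (rule SUP_least)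
  finally show ?thesis .
qed

subsection \<open>A program logic for expected time\<close>

text \<open>
  Charging \<open>\<infinity>\<close> outside \<open>Q\<close> (and, by \<open>expect\<close>, for nontermination) makes a bound on the expected
  time assert almost sure termination and the postcondition \<open>Q\<close> as well.
\<close>

definition bnd :: "nat \<Rightarrow> graph \<Rightarrow> com \<Rightarrow> state \<Rightarrow> (state \<Rightarrow> bool) \<Rightarrow> (state \<Rightarrow> real) \<Rightarrow> real \<Rightarrow> bool"
  where "bnd W G p s Q g x \<longleftrightarrow>
    expect (exec W G p s) (\<lambda>s'. if Q s' \<and> 0 \<le> g s' then ennreal (g s') else \<infinity>) \<le> ennreal x"

lemma of_nat_ennreal_le:
  assumes "0 \<le> y" "real c + y \<le> x" shows "of_nat c + ennreal y \<le> ennreal x"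
  using assms by (simp add: ennreal_of_nat_eq_real_of_nat ennreal_leI flip: ennreal_plus)

section \<open>Rules for the program constructs\<close>

lemma bnd_Skip: "Q s \<Longrightarrow> 0 \<le> g s \<Longrightarrow> 1 + g s \<le> x \<Longrightarrow> bnd W G Skip s Q g x"
  using of_nat_ennreal_le[of "g s" 1 x] by (simp add: bnd_def)

lemma bnd_Assign:
  assumes "s' = s\<lparr>vars := (vars s)(y := aval W G e s)\<rparr>"
    and "Q s'" "0 \<le> g s'" "1 + real (acost e) + g s' \<le> x"
  shows "bnd W G (Assign y e) s Q g x"
  using assms of_nat_ennreal_le[of "g s'" "1 + acost e" x] by (simp add: bnd_def)

lemma bnd_Store:
  assumes "s' = s\<lparr>arrs := (arrs s)(a := (arrs s a)(aval W G e s := aval W G f s))\<rparr>"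
    and "Q s'" "0 \<le> g s'" "1 + real (acost e) + real (acost f) + g s' \<le> x"
  shows "bnd W G (Store a e f) s Q g x"
  using assms of_nat_ennreal_le[of "g s'" "1 + acost e + acost f" x] by (simp add: bnd_def)

lemma bnd_Cond:
  assumes "bval W G b s \<Longrightarrow> bnd W G p s Q g (x - (1 + real (bcost b)))"
    and "\<not> bval W G b s \<Longrightarrow> bnd W G q s Q g (x - (1 + real (bcost b)))"
    and "1 + real (bcost b) \<le> x"
  shows "bnd W G (Cond b p q) s Q g x"
proof -
  have "of_nat (1 + bcost b) + ennreal (x - (1 + real (bcost b))) \<le> ennreal x"
    using assms(3) by (intro of_nat_ennreal_le) auto
  then show ?thesis
    using assms(1,2) unfolding bnd_def
    by (auto intro: order_trans[OF add_left_mono] simp del: of_nat_Suc of_nat_add)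
qed

text \<open>\<open>h\<close> is the time budget left between the two programs. It may be assumed
  nonnegative, since a state with negative budget has already been charged infinity.\<close>

lemma bnd_Seq:
  assumes "bnd W G p s R h x" and "\<And>s'. R s' \<Longrightarrow> 0 \<le> h s' \<Longrightarrow> bnd W G q s' Q g (h s')"
  shows "bnd W G (Seq p q) s Q g x"
proof -
  have "expect (exec W G (Seq p q) s) (\<lambda>s'. if Q s' \<and> 0 \<le> g s' then ennreal (g s') else \<infinity>) \<le>
      expect (exec W G p s) (\<lambda>s'. if R s' \<and> 0 \<le> h s' then ennreal (h s') else \<infinity>)"
    unfolding exec.simps expect_bind_tick using assms(2)
    by (intro expect_mono) (auto simp: bnd_def)
  then show ?thesis using assms(1) unfolding bnd_def by (rule order_trans)
qed

lemma bnd_Seq_Assign: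
  assumes "s' = s\<lparr>vars := (vars s)(y := aval W G e s)\<rparr>"
    and "bnd W G q s' Q g (x - (1 + real (acost e)))" "1 + real (acost e) \<le> x"
  shows "bnd W G (Seq (Assign y e) q) s Q g x"
  by (rule bnd_Seq[where R="\<lambda>t. t = s'" and h="\<lambda>_. x - (1 + real (acost e))"])
    (use assms in \<open>auto intro!: bnd_Assign\<close>)

lemma bnd_Seq_Store:
  assumes "s' = s\<lparr>arrs := (arrs s)(a := (arrs s a)(aval W G e s := aval W G f s))\<rparr>"
    and "bnd W G q s' Q g (x - (1 + real (acost e) + real (acost f)))"
    and "1 + real (acost e) + real (acost f) \<le> x"
  shows "bnd W G (Seq (Store a e f) q) s Q g x"
  by (rule bnd_Seq[where R="\<lambda>t. t = s'" and h="\<lambda>_. x - (1 + real (acost e) + real (acost f))"])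
    (use assms in \<open>auto intro!: bnd_Store\<close>)

lemma expect_uniform:
  assumes "0 < m"
  shows "expect (map_spmf (\<lambda>r. (f r, c)) (spmf_of_set {..<m})) \<phi> =
    (\<Sum>r<m. of_nat c + \<phi> (f r)) / of_nat m"
proof -
  have ne: "{..<m} \<noteq> {}" "finite {..<m}" using assms by auto
  have "spmf_of_set {..<m} = spmf_of_pmf (pmf_of_set {..<m})"
    using ne by simp
  then have "map_spmf (\<lambda>r. (f r, c)) (spmf_of_set {..<m}) =
      map_pmf (\<lambda>r. Some (f r, c)) (pmf_of_set {..<m})"
    by (simp add: spmf_of_pmf_def pmf.map_comp o_def)
  then show ?thesis
    using ne by (simp add: expect_def nn_integral_pmf_of_set)
qed

text \<open>The budget \<open>h r\<close> may depend on the drawn value; only its mean has to fit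
  into \<open>x\<close>. All averaging in the analysis enters here.\<close>

lemma bnd_Seq_Rand:
  assumes m: "aval W G e s = m" "0 < m"
    and q: "\<And>r. r < m \<Longrightarrow> bnd W G q (s\<lparr>vars := (vars s)(y := r)\<rparr>) Q g (h r)"
    and h: "\<And>r. r < m \<Longrightarrow> 0 \<le> h r"
    and x: "1 + real (acost e) + (\<Sum>r<m. h r) / real m \<le> x"
  shows "bnd W G (Seq (Rand y e) q) s Q g x"
proof -
  let ?\<phi> = "\<lambda>s'. if Q s' \<and> 0 \<le> g s' then ennreal (g s') else \<infinity>"
  have "expect (exec W G (Seq (Rand y e) q) s) ?\<phi> =
      (\<Sum>r<m. of_nat (1 + acost e) + expect (exec W G q (s\<lparr>vars := (vars s)(y := r)\<rparr>)) ?\<phi>) / of_nat m"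
    unfolding exec.simps expect_bind_tick using m
    by (simp add: expect_uniform max_absorb2 Suc_le_eq)
  also have "\<dots> \<le> (\<Sum>r<m. ennreal (1 + real (acost e) + h r)) / of_nat m"
  proof (intro divide_right_mono_ennreal sum_mono)
    fix r assume r: "r \<in> {..<m}"
    have "of_nat (1 + acost e) + expect (exec W G q (s\<lparr>vars := (vars s)(y := r)\<rparr>)) ?\<phi> \<le>
        of_nat (1 + acost e) + ennreal (h r)"
      using q[of r] r unfolding bnd_def by (intro add_left_mono) auto
    also have "\<dots> \<le> ennreal (1 + real (acost e) + h r)"
      using h[of r] r by (intro of_nat_ennreal_le) auto
    finally show "of_nat (1 + acost e) + expect (exec W G q (s\<lparr>vars := (vars s)(y := r)\<rparr>)) ?\<phi> \<le>
        ennreal (1 + real (acost e) + h r)" .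
  qed
  also have "\<dots> = ennreal ((\<Sum>r<m. 1 + real (acost e) + h r) / real m)"
    using m(2) h
    by (subst sum_ennreal) (auto simp: ennreal_of_nat_eq_real_of_nat
        intro!: divide_ennreal sum_nonneg add_nonneg_nonneg)
  also have "(\<Sum>r<m. 1 + real (acost e) + h r) / real m = 1 + real (acost e) + (\<Sum>r<m. h r) / real m"
    using m(2) by (simp add: sum.distrib field_simps)
  also have "ennreal \<dots> \<le> ennreal x" using x by (rule ennreal_leI)
  finally show ?thesis unfolding bnd_def .
qed

text \<open>The invariant \<open>I\<close> and the potential \<open>f\<close> combine into a
  superinvariant for \<open>expect_loop_le\<close>, infinite outside \<open>I\<close>. The potential
  must always cover one evaluation of the guard, including the last, failing one.\<close>

lemma bnd_While:
  assumes inv: "I s" "f s \<le> x"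
    and nonneg: "\<And>s. I s \<Longrightarrow> 1 + real (bcost b) \<le> f s"
    and step: "\<And>s. I s \<Longrightarrow> bval W G b s \<Longrightarrow> bnd W G p s I f (f s - (1 + real (bcost b)))"
    and exit: "\<And>s. I s \<Longrightarrow> \<not> bval W G b s \<Longrightarrow>
      Q s \<and> 0 \<le> g s \<and> 1 + real (bcost b) + g s \<le> f s"
  shows "bnd W G (While b p) s Q g x"
proof -
  let ?I = "\<lambda>s. if I s \<and> 0 \<le> f s then ennreal (f s) else \<infinity>"
  have "expect (exec W G (While b p) s) (\<lambda>s'. if Q s' \<and> 0 \<le> g s' then ennreal (g s') else \<infinity>) \<le> ?I s"
    unfolding exec.simps
  proof (rule expect_loop_le)
    fix s assume b: "bval W G b s"
    show "of_nat (1 + bcost b) + expect (exec W G p s) ?I \<le> ?I s"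
    proof (cases "I s")
      case True
      have "of_nat (1 + bcost b) + expect (exec W G p s) ?I \<le>
          of_nat (1 + bcost b) + ennreal (f s - (1 + real (bcost b)))"
        using step[OF True b] unfolding bnd_def by (rule add_left_mono)
      also have "\<dots> \<le> ennreal (f s)"
        using nonneg[OF True] by (intro of_nat_ennreal_le) auto
      finally show ?thesis by auto
    qed auto
  next
    fix s assume b: "\<not> bval W G b s"
    show "of_nat (1 + bcost b) + (if Q s \<and> 0 \<le> g s then ennreal (g s) else \<infinity>) \<le> ?I s"
      using exit[OF _ b] by (auto intro!: of_nat_ennreal_le simp del: of_nat_Suc)
  qed simp
  also have "?I s \<le> ennreal x"
    using inv nonneg[OF inv(1)] by (auto intro: ennreal_leI)
  finally show ?thesis unfolding bnd_def .
qed

lemma bnd_conseq: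
  assumes "bnd W G p s R h y" "y \<le> x"
    and "\<And>s'. R s' \<Longrightarrow> 0 \<le> h s' \<Longrightarrow> Q s' \<and> 0 \<le> g s' \<and> g s' \<le> h s'"
  shows "bnd W G p s Q g x"
proof -
  have "expect (exec W G p s) (\<lambda>s'. if Q s' \<and> 0 \<le> g s' then ennreal (g s') else \<infinity>) \<le>
      expect (exec W G p s) (\<lambda>s'. if R s' \<and> 0 \<le> h s' then ennreal (h s') else \<infinity>)"
    using assms(3) by (intro expect_mono) (auto intro: ennreal_leI)
  also have "\<dots> \<le> ennreal y" using assms(1) unfolding bnd_def .
  also have "\<dots> \<le> ennreal x" using assms(2) by (rule ennreal_leI)
  finally show ?thesis unfolding bnd_def .
qed

lemma expect_add_const: "expect p (\<lambda>s. \<phi> s + c) = expect p \<phi> + c"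
proof -
  have "expect p (\<lambda>s. \<phi> s + c) = (\<integral>\<^sup>+ r. (case r of None \<Rightarrow> \<infinity> | Some (s, t) \<Rightarrow> of_nat t + \<phi> s) + c
      \<partial>measure_pmf p)"
    unfolding expect_def by (auto intro!: nn_integral_cong split: option.splits simp: add.assoc)
  also have "\<dots> = expect p \<phi> + c"
    unfolding expect_def by (subst nn_integral_add) auto
  finally show ?thesis .
qed

text \<open>A frame rule: time not spent by \<open>p\<close> is carried over to what
  follows.\<close>

lemma bnd_add_const:
  assumes "bnd W G p s Q (\<lambda>_. 0) x" "0 \<le> x" "0 \<le> y"
  shows "bnd W G p s Q (\<lambda>_. y) (x + y)"
proof -
  have "expect (exec W G p s) (\<lambda>s'. if Q s' \<and> 0 \<le> y then ennreal y else \<infinity>) \<le>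
      expect (exec W G p s) (\<lambda>s'. (if Q s' then 0 else \<infinity>) + ennreal y)"
    using assms(3) by (intro expect_mono) auto
  also have "\<dots> \<le> ennreal x + ennreal y"
    unfolding expect_add_const using assms(1)
    by (intro add_right_mono) (simp add: bnd_def cong: if_cong)
  finally show ?thesis using assms(2,3) unfolding bnd_def by simp
qed

lemma bnd_Seq_const:
  assumes "bnd W G p s R (\<lambda>_. 0) y" "0 \<le> y" "y \<le> x"
    and "\<And>s'. R s' \<Longrightarrow> bnd W G q s' Q g (x - y)"
  shows "bnd W G (Seq p q) s Q g x"
  using bnd_Seq[OF bnd_add_const[OF assms(1,2), of "x - y"] assms(4)] assms(3) by simp

text \<open>A single finite bound yields all three claims, because both nontermination and a wrong
  output would make the expectation infinite.\<close>

lemma bnd_run: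
  assumes "bnd (word_count k (nverts G)) G P (init_state G) (\<lambda>s. Q (arrs s ''color'')) (\<lambda>_. 0) x"
  shows "lossless_spmf (run k P G)" "\<forall>(col, t) \<in> set_spmf (run k P G). Q col"
    and "expected_time k P G \<le> ennreal x"
proof -
  let ?p = "exec (word_count k (nverts G)) G P (init_state G)"
  let ?\<phi> = "\<lambda>s. if Q (arrs s ''color'') then 0 else \<infinity> :: ennreal"
  have le: "expect ?p ?\<phi> \<le> ennreal x"
    using assms unfolding bnd_def by (simp cong: if_cong)
  then have fin: "expect ?p ?\<phi> < \<infinity>" by (rule order_le_less_trans) simp
  show "lossless_spmf (run k P G)"
    using expect_finite(1)[OF fin] by (simp add: run_def)
  show "\<forall>(col, t) \<in> set_spmf (run k P G). Q col"
    using expect_finite(2)[OF fin] by (force simp: run_def split: if_splits)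
  have "expected_time k P G = expect ?p (\<lambda>_. 0)"
    unfolding expected_time_def run_def expect_def
    by (auto intro!: nn_integral_cong split: option.splits)
  also have "\<dots> \<le> expect ?p ?\<phi>" by (rule expect_mono) simp
  finally show "expected_time k P G \<le> ennreal x" using le by (rule order_trans)
qed

subsection \<open>Graphs and the potential of a random order\<close>

lemma not_self_nbr: "valid_graph G \<Longrightarrow> v \<notin> nbrs G v"
  unfolding valid_graph_def nbrs_def by (fastforce simp: doubleton_eq_iff)

lemma nbrs_less: "valid_graph G \<Longrightarrow> u \<in> nbrs G v \<Longrightarrow> u < nverts G"
  unfolding valid_graph_def nbrs_def by (fastforce simp: doubleton_eq_iff)

lemma finite_nbrs: "valid_graph G \<Longrightarrow> finite (nbrs G v)"
  by (rule finite_subset[of _ "{..<nverts G}"]) (auto dest: nbrs_less)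

lemma length_adj_list: "valid_graph G \<Longrightarrow> v < nverts G \<Longrightarrow> length (adj_list G v) = degree G v"
  unfolding valid_graph_def degree_def by (metis distinct_card)

lemma degree_le_max_degree: "v < nverts G \<Longrightarrow> degree G v \<le> max_degree G"
  unfolding max_degree_def by (intro Max_ge) auto

lemma degree_less_nverts:
  assumes "valid_graph G" "v < nverts G"
  shows "degree G v < nverts G"
proof -
  have "nbrs G v \<subseteq> {..<nverts G} - {v}"
    using assms not_self_nbr nbrs_less by blast
  from card_mono[OF _ this] show ?thesis
    using assms unfolding degree_def by simp
qed

lemma max_degree_less_nverts:
  assumes "valid_graph G" "0 < nverts G"
  shows "max_degree G < nverts G"
  using assms degree_less_nverts unfolding max_degree_def by auto

text \<open>Every coloured neighbour blocks at most one of the \<open>\<Delta> + 1\<close> colours,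
  and the uncoloured ones block none. Colours are shifted by one because 0 means uncoloured.\<close>

lemma card_free_colours:
  assumes "valid_graph G" "v < nverts G"
  shows "1 + (max_degree G - degree G v) + card (nbrs G v \<inter> {u. u < nverts G \<and> col u = 0})
    \<le> card {c. c < max_degree G + 1 \<and> (\<forall>u \<in> nbrs G v. col u \<noteq> c + 1)}"
    (is "_ + card ?U \<le> card ?good")
proof -
  let ?C = "{u \<in> nbrs G v. col u \<noteq> 0}"
  have fin: "finite (nbrs G v)" using assms finite_nbrs by blast
  have "nbrs G v = ?U \<union> ?C" using nbrs_less[OF assms(1)] by auto
  then have deg: "degree G v = card ?U + card ?C"
    unfolding degree_def using fin by (subst card_Un_disjoint[symmetric]) auto
  have "{..<max_degree G + 1} \<subseteq> ?good \<union> (\<lambda>u. col u - 1) ` ?C" by force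
  from card_mono[OF _ this]
  have "max_degree G + 1 \<le> card ?good + card ((\<lambda>u. col u - 1) ` ?C)"
    using fin card_Un_le[of ?good "(\<lambda>u. col u - 1) ` ?C"] by simp
  moreover have "card ((\<lambda>u. col u - 1) ` ?C) \<le> card ?C"
    using fin by (intro card_image_le) auto
  ultimately show ?thesis
    using deg degree_le_max_degree[OF assms(2)] by linarith
qed

text \<open>
  The mean of \<open>1 / (1 + s + Y)\<close> for \<open>Y\<close> uniform on \<open>{0..d}\<close>: in a uniformly random order of a
  vertex and \<open>d\<close> neighbours, the number of neighbours that come later is distributed like \<open>Y\<close>.
\<close>

definition mean_inv :: "nat \<Rightarrow> nat \<Rightarrow> real" where
  "mean_inv s d = (\<Sum>j\<le>d. 1 / (1 + real s + real j)) / (real d + 1)"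

lemma mean_inv_nonneg: "0 \<le> mean_inv s d"
  unfolding mean_inv_def by (intro divide_nonneg_nonneg sum_nonneg) auto

text \<open>First-step analysis of the random order: with probability \<open>1 / (d + 1)\<close> the
  vertex precedes all \<open>d\<close> neighbours, otherwise a neighbour comes first and
  \<open>d - 1\<close> remain. For \<open>d = 0\<close> the factor \<open>real d\<close> cancels the
  truncated \<open>d - 1\<close>.\<close>

lemma mean_inv_rec:
  "(real d + 1) * mean_inv s d = 1 / (1 + real s + real d) + real d * mean_inv s (d - 1)"
  by (cases d) (auto simp: mean_inv_def add.commute)

text \<open>The terms \<open>1 / k\<close> decrease, so the mean of the last \<open>d + 1\<close> of
  them is at most the mean of all \<open>s + d + 1\<close>. With slack
  \<open>s = \<Delta> - deg\<close> the bound is the same for every degree.\<close>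

lemma mean_inv_le_harm: "mean_inv s d \<le> harm (s + d + 1) / real (s + d + 1)"
proof -
  define S where "S = (\<Sum>j\<le>d. 1 / (1 + real s + real j))"
  have harm: "harm (s + d + 1) = harm s + S"
  proof -
    have "harm (s + d + 1) = harm s + (\<Sum>k = s + 1..s + d + 1. inverse (real k))"
      unfolding harm_def using sum.ub_add_nat[of 1 s "\<lambda>k. inverse (real k)" "d + 1"]
      by (simp add: add.assoc)
    also have "(\<Sum>k = s + 1..s + d + 1. inverse (real k)) = S"
      unfolding S_def
      by (rule sum.reindex_bij_witness[where i="\<lambda>j. s + j + 1" and j="\<lambda>k. k - s - 1"])
        (auto simp: field_simps)
    finally show ?thesis .
  qed
  \<comment> \<open>This is the comparison of means with denominators cleared: every term of
    \<open>S\<close> is at most \<open>1 / s\<close>, and \<open>harm s \<ge> 1\<close> unless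
    \<open>s = 0\<close>.\<close>
  have "real s * S \<le> (real d + 1) * harm s"
  proof (cases "s = 0")
    case False
    have "S \<le> (\<Sum>j\<le>d. 1 / real s)"
      unfolding S_def using False by (intro sum_mono divide_left_mono) auto
    then have "S \<le> (real d + 1) * (1 / real s)" by (simp add: add.commute)
    from mult_left_mono[OF this, of "real s"] have "real s * S \<le> (real d + 1) * 1"
      using False by simp
    also have "\<dots> \<le> (real d + 1) * harm s"
    proof (intro mult_left_mono)
      have "(harm 1 :: real) \<le> harm s" using False by (intro harm_mono) auto
      then show "(1::real) \<le> harm s" by (simp add: harm_def)
    qed simp
    finally show ?thesis .
  qed (simp add: harm_def)
  then have "S * (real s + real d + 1) \<le> (harm s + S) * (real d + 1)"
    by (simp add: algebra_simps)
  then show ?thesis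
    unfolding mean_inv_def harm S_def[symmetric] by (simp add: field_simps)
qed

text \<open>The expectation, over a uniformly random order of \<open>U\<close>, of the sum of the
  reciprocals of the guaranteed numbers of free colours.\<close>

definition potential :: "graph \<Rightarrow> nat set \<Rightarrow> real" where
  "potential G U = (\<Sum>w\<in>U. mean_inv (max_degree G - degree G w) (card (nbrs G w \<inter> U)))"

lemma potential_nonneg: "0 \<le> potential G U"
  unfolding potential_def by (intro sum_nonneg mean_inv_nonneg)

text \<open>Divided by \<open>card U\<close>, this is the balance of one random step: the mean
  reciprocal paid now plus the mean potential left equals the present potential.\<close>

lemma potential_remove_random:
  assumes G: "valid_graph G" and U: "finite U"
  shows "(\<Sum>v\<in>U. 1 / (1 + real (max_degree G - degree G v) + real (card (nbrs G v \<inter> U)))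
      + potential G (U - {v})) = real (card U) * potential G U"
proof -
  define sl where "sl w = max_degree G - degree G w" for w
  define d where "d w = card (nbrs G w \<inter> U)" for w
  have eq: "card (nbrs G w \<inter> (U - {v})) = (if v \<in> nbrs G w then d w - 1 else d w)"
    if "v \<in> U" for v w
  proof -
    have "nbrs G w \<inter> (U - {v}) = (nbrs G w \<inter> U) - {v}" by auto
    then show ?thesis using that by (auto simp: d_def)
  qed
  have "(\<Sum>v\<in>U. potential G (U - {v})) =
      (\<Sum>v\<in>U. \<Sum>w\<in>U - {v}. mean_inv (sl w) (if v \<in> nbrs G w then d w - 1 else d w))"
    unfolding potential_def sl_def by (intro sum.cong) (auto simp: eq)
  \<comment> \<open>Fix the survivor \<open>w\<close> instead of the removed \<open>v\<close>: among
    the other \<open>card U - 1\<close> vertices, exactly \<open>d w\<close> are neighbours, whose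
    removal lowers the count of \<open>w\<close> by one.\<close>
  also have "\<dots> = (\<Sum>w\<in>U. \<Sum>v\<in>U - {w}. mean_inv (sl w) (if v \<in> nbrs G w then d w - 1 else d w))"
    using U by (simp add: sum.If_cases sum_diff1 sum_subtractf not_self_nbr[OF G]) (rule sum.swap)
  also have "\<dots> = (\<Sum>w\<in>U. real (d w) * mean_inv (sl w) (d w - 1)
      + (real (card U) - 1 - real (d w)) * mean_inv (sl w) (d w))"
  proof (intro sum.cong refl)
    fix w assume w: "w \<in> U"
    have split: "U - {w} = (nbrs G w \<inter> U) \<union> (U - {w} - nbrs G w)"
      using not_self_nbr[OF G, of w] by auto
    have c: "card (U - {w}) = card U - 1" "0 < card U"
      using U w by (auto simp: card_gt_0_iff)
    have dis: "card (U - {w}) = d w + card (U - {w} - nbrs G w)"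
      unfolding d_def using U by (subst split, subst card_Un_disjoint) auto
    have "(\<Sum>v\<in>U - {w}. mean_inv (sl w) (if v \<in> nbrs G w then d w - 1 else d w)) =
        (\<Sum>v\<in>nbrs G w \<inter> U. mean_inv (sl w) (d w - 1)) +
        (\<Sum>v\<in>U - {w} - nbrs G w. mean_inv (sl w) (d w))"
      using U by (subst split, subst sum.union_disjoint) (auto intro!: arg_cong2[where f="(+)"] sum.cong)
    also have "\<dots> = real (d w) * mean_inv (sl w) (d w - 1)
        + (real (card U) - 1 - real (d w)) * mean_inv (sl w) (d w)"
    proof -
      have "real (card (U - {w} - nbrs G w)) = real (card U) - 1 - real (d w)"
        using c dis by linarith
      then show ?thesis by (simp add: d_def[of w, symmetric])
    qed
    finally show "(\<Sum>v\<in>U - {w}. mean_inv (sl w) (if v \<in> nbrs G w then d w - 1 else d w)) =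
        real (d w) * mean_inv (sl w) (d w - 1)
        + (real (card U) - 1 - real (d w)) * mean_inv (sl w) (d w)" .
  qed
  finally have "(\<Sum>v\<in>U. 1 / (1 + real (sl v) + real (d v)) + potential G (U - {v})) =
      (\<Sum>w\<in>U. (1 / (1 + real (sl w) + real (d w)) + real (d w) * mean_inv (sl w) (d w - 1))
      + (real (card U) - 1 - real (d w)) * mean_inv (sl w) (d w))"
    by (simp add: sum.distrib)
  \<comment> \<open>The reciprocal of \<open>w\<close> and its neighbour term form
    \<open>(d w + 1) * mean_inv\<close>, so the coefficients add up to
    \<open>card U\<close>.\<close>
  also have "\<dots> = (\<Sum>w\<in>U. real (card U) * mean_inv (sl w) (d w))"
    unfolding mean_inv_rec[symmetric] by (simp add: algebra_simps)
  also have "\<dots> = real (card U) * potential G U"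
    unfolding potential_def sl_def d_def by (simp add: sum_distrib_left)
  finally show ?thesis unfolding sl_def d_def .
qed

lemma potential_le_harm:
  assumes G: "valid_graph G"
  shows "potential G {..<nverts G} \<le>
    real (nverts G) * (harm (max_degree G + 1) / real (max_degree G + 1))"
proof -
  have "mean_inv (max_degree G - degree G w) (card (nbrs G w \<inter> {..<nverts G})) \<le>
      harm (max_degree G + 1) / real (max_degree G + 1)" if "w < nverts G" for w
  proof -
    have "nbrs G w \<inter> {..<nverts G} = nbrs G w" using nbrs_less[OF G] by auto
    moreover have "max_degree G - degree G w + degree G w = max_degree G"
      using degree_le_max_degree[OF that] by simp
    ultimately show ?thesis
      using mean_inv_le_harm[of "max_degree G - degree G w" "degree G w"]
      by (simp add: degree_def)
  qed
  then have "potential G {..<nverts G} \<le>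
      (\<Sum>w<nverts G. harm (max_degree G + 1) / real (max_degree G + 1))"
    unfolding potential_def by (intro sum_mono) auto
  then show ?thesis by simp
qed

text \<open>Each dyadic block contributes at most 1. Powers of two suffice because
  \<open>log_com\<close> finds \<open>k\<close> with \<open>n \<le> 2 ^ k\<close>.\<close>

lemma harm_power2_le: "harm (2 ^ k) \<le> real k + 1"
proof (induction k)
  case (Suc k)
  have "harm (2 ^ Suc k) = harm (2 ^ k) + (\<Sum>j = 2 ^ k + 1..2 ^ k + 2 ^ k. inverse (real j))"
    unfolding harm_def power_Suc mult_2
    using sum.ub_add_nat[of 1 "2 ^ k" "\<lambda>j. inverse (real j)" "2 ^ k"] by simp
  also have "(\<Sum>j = 2 ^ k + 1..2 ^ k + 2 ^ k. inverse (real j)) \<le>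
      (\<Sum>j = (2::nat) ^ k + 1..2 ^ k + 2 ^ k. inverse (2 ^ k))"
    by (intro sum_mono le_imp_inverse_le) (auto simp flip: of_nat_le_iff)
  also have "\<dots> = 1" by simp
  finally show ?case using Suc by simp
qed (simp add: harm_def)

subsection \<open>The program\<close>

abbreviation incr :: "name \<Rightarrow> com" where
  "incr x \<equiv> Assign x (Plus (Var x) (Const 1))"

definition max_degree_com :: com where
  "max_degree_com = While (Less (Var ''i'') (Var ''n''))
     (Seq (Cond (Less (Var ''d'') (Deg (Var ''i''))) (Assign ''d'' (Deg (Var ''i''))) Skip)
          (incr ''i''))"

text \<open>\<open>l\<close> ends as \<open>k + 1\<close> for the least power \<open>2 ^ k\<close>
  that is at least \<open>n\<close>. The variable \<open>p\<close> is distinct from the array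
  \<open>p\<close> used later.\<close>

definition log_com :: com where
  "log_com = Seq (Assign ''p'' (Const 1)) (Seq (Assign ''l'' (Const 1))
     (While (Less (Var ''p'') (Var ''n''))
       (Seq (Assign ''p'' (Plus (Var ''p'') (Var ''p''))) (incr ''l''))))"

text \<open>
  The entry \<open>used[c]\<close> holds \<open>v + 1\<close> for the last vertex \<open>v\<close> that has seen colour \<open>c\<close> at a
  neighbour; these time stamps save clearing the array for every vertex.
\<close>

definition mark_com :: com where
  "mark_com = While (Less (Var ''i'') (Deg (Var ''v'')))
     (Seq (Store ''used'' (Read ''color'' (Nbr (Var ''v'') (Var ''i''))) (Plus (Var ''v'') (Const 1)))
          (incr ''i''))"

definition search_com :: com where
  "search_com = While (Eq (Read ''used'' (Var ''c'')) (Plus (Var ''v'') (Const 1))) (incr ''c'')"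

text \<open>Uncoloured neighbours stamp entry 0; the search starts at 1 and never sees it.\<close>

definition greedy_com :: com where
  "greedy_com = Seq (Assign ''v'' (Const 0)) (While (Less (Var ''v'') (Var ''n''))
     (Seq (Assign ''i'' (Const 0)) (Seq mark_com
     (Seq (Assign ''c'' (Const 1)) (Seq search_com
     (Seq (Store ''color'' (Var ''v'') (Var ''c'')) (incr ''v'')))))))"

text \<open>The scan has no early exit, so its cost is linear in the size of the class.\<close>

definition check_com :: com where
  "check_com = While (Less (Var ''i'') (Read ''cnt'' (Var ''c'')))
     (Seq (Cond (Eq (Adj (Var ''v'')
              (Read ''cls'' (Plus (Times (Var ''c'') (Var ''n'')) (Var ''i'')))) (Const 1))
            (Assign ''ok'' (Const 0)) Skip)
          (incr ''i''))"

definition sample_com :: com where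
  "sample_com = While (Eq (Var ''ok'') (Const 0))
     (Seq (Rand ''c'' (Plus (Var ''d'') (Const 1)))
     (Seq (Assign ''ok'' (Const 1)) (Seq (Assign ''i'' (Const 0)) check_com)))"

definition init_perm_com :: com where
  "init_perm_com = While (Less (Var ''i'') (Var ''n''))
     (Seq (Store ''p'' (Var ''i'') (Var ''i'')) (incr ''i''))"

text \<open>
  Colour \<open>0\<close> means uncoloured, and the first \<open>m\<close> entries of \<open>p\<close> are the uncoloured vertices; the
  drawn entry is overwritten by the last one.
\<close>

definition random_com :: com where
  "random_com = Seq (Assign ''i'' (Const 0)) (Seq init_perm_com (Seq (Assign ''m'' (Var ''n''))
     (While (Less (Const 0) (Var ''m''))
       (Seq (Rand ''r'' (Var ''m'')) (Seq (Assign ''v'' (Read ''p'' (Var ''r'')))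
       (Seq (Assign ''m'' (Minus (Var ''m'') (Const 1)))
       (Seq (Store ''p'' (Var ''r'') (Read ''p'' (Var ''m'')))
       (Seq (Assign ''ok'' (Const 0)) (Seq sample_com
       (Seq (Store ''color'' (Var ''v'') (Plus (Var ''c'') (Const 1)))
       (Seq (Store ''cls'' (Plus (Times (Var ''c'') (Var ''n'')) (Read ''cnt'' (Var ''c''))) (Var ''v''))
            (Store ''cnt'' (Var ''c'') (Plus (Read ''cnt'' (Var ''c'')) (Const 1))))))))))))))"

text \<open>Comparing squares decides between the two regimes without computing a square
  root.\<close>

definition colouring_com :: com where
  "colouring_com = Seq max_degree_com (Seq log_com
     (Cond (Less (Times (Var ''d'') (Var ''d'')) (Times (Var ''n'') (Var ''l'')))
        greedy_com random_com))"

subsection \<open>The deterministic part\<close>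

text \<open>Words of quadratic range keep the products in the branch test and the indices
  \<open>c * N + j\<close> of the class table from wrapping around.\<close>

locale colouring_ram =
  fixes W :: nat and G :: graph
  assumes G: "valid_graph G" and W: "(nverts G + 2) ^ 2 \<le> W"
begin

abbreviation "N \<equiv> nverts G"
abbreviation "D \<equiv> max_degree G"

lemma less_W: "k < (N + 2) * (N + 2) \<Longrightarrow> k < W"
  using W by (simp add: power2_eq_square)

text \<open>Prevents \<open>Const 1\<close> from evaluating to 0.\<close>

lemma W_neq_1 [simp]: "W \<noteq> Suc 0"
  using less_W[of 1] by simp

lemma small_mod_W: "k \<le> N + 2 \<Longrightarrow> k mod W = k"
  by (rule mod_less, rule less_W) simp

lemma D_le: "D \<le> N"
proof (cases "N = 0")
  case False
  then show ?thesis using max_degree_less_nverts[OF G] by (intro less_imp_le) simp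
qed (simp add: max_degree_def)

section \<open>Maximum degree and logarithm\<close>

lemma bnd_max_degree:
  assumes "vars s ''n'' = N" "vars s ''i'' = 0" "vars s ''d'' = 0"
  shows "bnd W G max_degree_com s
    (\<lambda>s'. arrs s' = arrs s \<and> vars s' ''n'' = N \<and> vars s' ''d'' = D) (\<lambda>_. 0) (16 * N + 4)"
  unfolding max_degree_com_def
\<comment> \<open>A round costs 4 for the guard, 5 for the comparison, at most 3 for the update and
  4 for the increment; the extra 4 pays for the final test. The potentials of the other loops are
  composed in the same way.\<close>
proof (rule bnd_While[where I="\<lambda>s'. arrs s' = arrs s \<and> vars s' ''n'' = N \<and> vars s' ''i'' \<le> N \<and>
      vars s' ''d'' = Max (insert 0 (degree G ` {..<vars s' ''i''}))"
      and f="\<lambda>s'. 16 * (real N - real (vars s' ''i'')) + 4"], goal_cases)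
  case (4 t)
  let ?i = "vars t ''i''"
  have i: "?i < N" using 4 by simp
  have "Max (insert 0 (degree G ` {..<Suc ?i})) =
      max (degree G ?i) (Max (insert 0 (degree G ` {..<?i})))"
    unfolding lessThan_Suc image_insert
    by (subst insert_commute, subst Max_insert) auto
  then have M: "Max (insert 0 (degree G ` {..<Suc ?i})) = max (degree G ?i) (vars t ''d'')"
    using 4 by simp
  have inc: "bnd W G (incr ''i'') t' (\<lambda>s'. arrs s' = arrs s \<and> vars s' ''n'' = N \<and> vars s' ''i'' \<le> N \<and>
      vars s' ''d'' = Max (insert 0 (degree G ` {..<vars s' ''i''})))
      (\<lambda>s'. 16 * (real N - real (vars s' ''i'')) + 4) (16 * (real N - ?i) - 8)"
    if "arrs t' = arrs s" "vars t' ''n'' = N" "vars t' ''i'' = ?i"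
      "vars t' ''d'' = max (degree G ?i) (vars t ''d'')" for t'
    by (rule bnd_Assign[OF refl]) (use that i M in \<open>auto simp: small_mod_W\<close>)
  have d: "bval W G (Less (Var ''d'') (Deg (Var ''i''))) t \<longleftrightarrow> vars t ''d'' < degree G ?i"
    using i by (simp add: length_adj_list[OF G])
  have t: "arrs t = arrs s" "vars t ''n'' = N" using 4 by auto
  show ?case
  proof (rule bnd_Seq[where R="\<lambda>t'. arrs t' = arrs s \<and> vars t' ''n'' = N \<and> vars t' ''i'' = ?i \<and>
        vars t' ''d'' = max (degree G ?i) (vars t ''d'')" and h="\<lambda>_. 16 * (real N - ?i) - 8"],
      rule bnd_Cond, goal_cases)
    case 1
    then show ?case unfolding d using 4(1) i
      by (intro bnd_Assign[OF refl]) (auto simp: length_adj_list[OF G])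
  next
    case 2
    then show ?case unfolding d using t i by (intro bnd_Skip) auto
  next
    case 3
    then show ?case using i by simp
  next
    case (4 t')
    then show ?case by (intro inc) auto
  qed
qed (use assms in \<open>auto simp: max_degree_def\<close>)

lemma bnd_log:
  assumes "vars s ''n'' = N"
  shows "bnd W G log_com s
    (\<lambda>s'. arrs s' = arrs s \<and> vars s' ''n'' = N \<and> vars s' ''d'' = vars s ''d'' \<and>
      (\<exists>k. vars s' ''l'' = Suc k \<and> N \<le> 2 ^ k \<and> (k = 0 \<or> 2 ^ (k - 1) < N))) (\<lambda>_. 0) (12 * N + 8)"
  unfolding log_com_def
  apply (rule bnd_Seq_Assign[OF refl])
   apply (rule bnd_Seq_Assign[OF refl])
\<comment> \<open>The number of rounds is bounded crudely by \<open>N\<close> instead of its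
  logarithm; linear time is affordable.\<close>
proof (rule bnd_While[where I="\<lambda>s'. arrs s' = arrs s \<and> vars s' ''n'' = N \<and>
      vars s' ''d'' = vars s ''d'' \<and> vars s' ''l'' \<le> N + 1 \<and>
      (\<exists>k. vars s' ''l'' = Suc k \<and> vars s' ''p'' = 2 ^ k \<and> (k = 0 \<or> 2 ^ (k - 1) < N))"
      and f="\<lambda>s'. 12 * (real N + 1 - real (vars s' ''l'')) + 4"], goal_cases)
  case (4 t)
  then obtain k where k: "vars t ''l'' = Suc k" "vars t ''p'' = 2 ^ k" by auto
  have N: "2 ^ k < N" using 4 k by simp
  then have kN: "k < N" using less_exp[of k] by (rule less_trans[rotated])
  have m: "2 * 2 ^ k mod W = 2 * 2 ^ k" using N by (intro mod_less less_W) auto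
  show ?case
    apply (rule bnd_Seq_Assign[OF refl])
     apply (rule bnd_Assign[OF refl])
    using 4 k kN N m by (auto simp: small_mod_W mult_2[symmetric])
qed (use assms in auto)

section \<open>Greedy colouring\<close>

lemma bnd_mark:
  assumes v: "vars s ''v'' < N" and i: "vars s ''i'' = 0"
    and used: "\<forall>x. arrs s ''used'' x \<le> vars s ''v''"
  shows "bnd W G mark_com s
    (\<lambda>s'. (\<forall>x. x \<noteq> ''i'' \<longrightarrow> vars s' x = vars s x) \<and> arrs s' ''color'' = arrs s ''color'' \<and>
      (\<forall>x. arrs s' ''used'' x \<le> vars s ''v'' + 1) \<and>
      {x. arrs s' ''used'' x = vars s ''v'' + 1} = arrs s ''color'' ` nbrs G (vars s ''v''))
    (\<lambda>_. 0) (17 * D + 5)"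
proof -
  define v where "v = vars s ''v''"
  define xs where "xs = adj_list G v"
  have xs: "set xs = nbrs G v" "length xs = degree G v" "length xs \<le> D"
    using G v length_adj_list[OF G] degree_le_max_degree[of v G]
    unfolding valid_graph_def xs_def v_def by auto
  have vN: "v < N" using v by (simp add: v_def)
  let ?I = "\<lambda>s'. (\<forall>x. x \<noteq> ''i'' \<longrightarrow> vars s' x = vars s x) \<and> arrs s' ''color'' = arrs s ''color'' \<and>
      vars s' ''i'' \<le> length xs \<and>
      arrs s' ''used'' = (\<lambda>x. if x \<in> arrs s ''color'' ` set (take (vars s' ''i'') xs) then v + 1
        else arrs s ''used'' x)"
  show ?thesis
    unfolding mark_com_def
  proof (rule bnd_While[where I="?I" and f="\<lambda>s'. 17 * (real D - real (vars s' ''i'')) + 5"], goal_cases)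
    case 1 then show ?case using i by (auto simp: fun_eq_iff)
  next
    case 2 then show ?case using i by auto
  next
    case 3 then show ?case using xs by auto
  next
    case (4 t)
    let ?i = "vars t ''i''"
    have tv: "vars t ''v'' = v" using 4 by (simp add: v_def)
    have iL: "?i < length xs" using 4 tv vN by (simp add: xs_def)
    have iN: "?i < N" using iL xs D_le by simp
    have tk: "set (take (Suc ?i) xs) = insert (xs ! ?i) (set (take ?i xs))"
      using iL by (simp add: take_Suc_conv_app_nth)
    show ?case
      apply (rule bnd_Seq_Store[OF refl])
       apply (rule bnd_Assign[OF refl])
      using 4 tv iL iN vN xs tk by (auto simp: small_mod_W fun_eq_iff xs_def[symmetric])
  next
    case (5 t)
    let ?i = "vars t ''i''"
    have tv: "vars t ''v'' = v" using 5 by (simp add: v_def)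
    have "?i = length xs" using 5 tv vN by (simp add: xs_def)
    then have u: "arrs t ''used'' = (\<lambda>x. if x \<in> arrs s ''color'' ` nbrs G v then v + 1
        else arrs s ''used'' x)" using 5 xs by simp
    \<comment> \<open>Older stamps are at most \<open>v\<close>, so \<open>v + 1\<close> occurs only
      where this loop has written it.\<close>
    have "arrs s ''used'' x \<noteq> Suc v" "arrs s ''used'' x \<le> Suc v" for x
      using used[rule_format, of x] by (auto simp: v_def)
    moreover have "vars t ''i'' \<le> D" using 5 xs by simp
    ultimately show ?case using conjunct1[OF 5(1)] conjunct1[OF conjunct2[OF 5(1)]]
      unfolding v_def[symmetric] u by auto
  qed
qed

text \<open>All colours skipped so far are stamped, and at most \<open>D\<close> entries are; hence
  the search stops within \<open>1..D + 1\<close>.\<close>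

lemma bnd_search:
  assumes v: "vars s ''v'' < N" and c: "vars s ''c'' = 1"
    and M: "finite {x. arrs s ''used'' x = vars s ''v'' + 1}"
      "card {x. arrs s ''used'' x = vars s ''v'' + 1} \<le> D"
  shows "bnd W G search_com s
    (\<lambda>s'. (\<forall>x. x \<noteq> ''c'' \<longrightarrow> vars s' x = vars s x) \<and> arrs s' = arrs s \<and>
      vars s' ''c'' \<in> {1..D + 1} \<and> arrs s ''used'' (vars s' ''c'') \<noteq> vars s ''v'' + 1)
    (\<lambda>_. 0) (11 * D + 7)"
proof -
  let ?M = "{x. arrs s ''used'' x = vars s ''v'' + 1}"
  let ?I = "\<lambda>s'. (\<forall>x. x \<noteq> ''c'' \<longrightarrow> vars s' x = vars s x) \<and> arrs s' = arrs s \<and>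
      1 \<le> vars s' ''c'' \<and> {1..<vars s' ''c''} \<subseteq> ?M"
  have le: "k \<le> D + 1" if "{1..<k} \<subseteq> ?M" for k
    using card_mono[OF M(1) that] M(2) by simp
  have mod: "Suc (vars s ''v'') mod W = Suc (vars s ''v'')" using v by (intro small_mod_W) simp
  show ?thesis
    unfolding search_com_def
  proof (rule bnd_While[where I="?I" and f="\<lambda>s'. 11 * (real D + 1 - real (vars s' ''c'')) + 7"], goal_cases)
    case 1 then show ?case using c by (auto simp: fun_eq_iff)
  next
    case 2 then show ?case using c by auto
  next
    case (3 t) then show ?case using le[of "vars t ''c''"] by auto
  next
    case (4 t)
    let ?c = "vars t ''c''"
    have tv: "vars t ''v'' = vars s ''v''" using 4 by simp
    have "?c \<in> ?M" using 4 tv mod by simp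
    with 4 have sub: "{1..<Suc ?c} \<subseteq> ?M" by (auto simp: less_Suc_eq)
    from le[OF this] have cD: "?c \<le> D" by simp
    then have m: "Suc ?c mod W = Suc ?c" using D_le by (intro small_mod_W) simp
    show ?case
      apply (rule bnd_Assign[OF refl])
      using 4 sub cD m by (auto simp: fun_eq_iff)
  next
    case (5 t)
    have tv: "vars t ''v'' = vars s ''v''" using 5 by simp
    then show ?case using 5 le[of "vars t ''c''"] mod by auto
  qed
qed

lemma bnd_greedy:
  assumes n: "vars s ''n'' = N" and used: "\<forall>x. arrs s ''used'' x = 0"
  shows "bnd W G greedy_com s (\<lambda>s'. proper_coloring G (D + 1) (arrs s' ''color'')) (\<lambda>_. 0)
    (28 * N * (D + 1) + 6)"
proof -
  let ?I = "\<lambda>s'. vars s' ''n'' = N \<and> vars s' ''v'' \<le> N \<and>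
      (\<forall>x. arrs s' ''used'' x \<le> vars s' ''v'') \<and>
      (\<forall>u<vars s' ''v''. arrs s' ''color'' u \<in> {1..D + 1}) \<and>
      (\<forall>u<vars s' ''v''. \<forall>w<vars s' ''v''. {u, w} \<in> edges G \<longrightarrow>
        arrs s' ''color'' u \<noteq> arrs s' ''color'' w)"
  \<comment> \<open>Marking and searching take at most \<open>28 * D + 12\<close> per vertex and the
    other instructions 15, which gives 27, rounded up to 28.\<close>
  let ?f = "\<lambda>s'. (28 * real D + 28) * (real N - real (vars s' ''v'')) + 4"
  show ?thesis
    unfolding greedy_com_def
  proof (rule bnd_Seq_Assign[OF refl], rule bnd_While[where I="?I" and f="?f"], goal_cases)
    case 1 then show ?case using n used by auto
  next
    case 2 then show ?case by (simp add: algebra_simps)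
  next
    case (3 t) then show ?case by simp
  next
    case (4 t)
    define v where "v = vars t ''v''"
    have v: "v < N" using 4 by (simp add: v_def)
    have f: "28 * real D + 28 + 4 \<le> ?f t"
    proof -
      have "(1::real) \<le> real N - real v" using v by simp
      then have "(28 * real D + 28) * 1 \<le> (28 * real D + 28) * (real N - real v)"
        by (intro mult_left_mono) auto
      then show ?thesis unfolding v_def[symmetric] mult_1_right by (rule add_right_mono)
    qed
    show ?case
    proof (rule bnd_Seq_Assign[OF refl], rule bnd_Seq_const[OF bnd_mark], goal_cases)
      case (6 t1)
      let ?M = "arrs t ''color'' ` nbrs G v"
      have M: "{x. arrs t1 ''used'' x = Suc v} = ?M" using 6 by (simp add: v_def)
      have fin: "finite (nbrs G v)" using G by (rule finite_nbrs)
      have cM: "card ?M \<le> D"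
        using card_image_le[OF fin, of "arrs t ''color''"] degree_le_max_degree[OF v]
        by (simp add: degree_def)
      have t1: "vars t1 ''v'' = v" "vars t1 ''n'' = N" "arrs t1 ''color'' = arrs t ''color''"
        using 6 4(1) by (auto simp: v_def fun_eq_iff split: if_splits)
      show ?case
      proof (rule bnd_Seq_Assign[OF refl], rule bnd_Seq_const[OF bnd_search], goal_cases)
        case (7 t2)
        let ?c = "vars t2 ''c''"
        have t2: "vars t2 ''v'' = v" "vars t2 ''n'' = N" "arrs t2 = arrs t1"
          using 7 t1 by (auto simp: fun_eq_iff split: if_splits)
        have c: "?c \<in> {1..D + 1}" using 7 by simp
        have "?c \<notin> ?M" using 7 M t1 by auto
        then have new: "arrs t ''color'' w \<noteq> ?c" if "w \<in> nbrs G v" for w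
          using that by (metis imageI)
        have vm: "Suc v mod W = Suc v" using v by (intro small_mod_W) simp
        have us: "\<forall>x. arrs t1 ''used'' x \<le> Suc v" using 6 by (simp add: v_def)
        \<comment> \<open>For \<open>u = w = v\<close> the edge \<open>{u, w}\<close> collapses to
          \<open>{v}\<close>.\<close>
        have noself: "{v} \<notin> edges G" using not_self_nbr[OF G, of v] by (simp add: nbrs_def)
        have old: "\<forall>u<v. arrs t ''color'' u \<in> {1..D + 1}"
          "\<forall>u<v. \<forall>w<v. {u, w} \<in> edges G \<longrightarrow> arrs t ''color'' u \<noteq> arrs t ''color'' w"
          using 4 by (auto simp: v_def)
        show ?case
        proof (rule bnd_Seq_Store[OF refl], rule bnd_Assign[OF refl], goal_cases)
          case 1
          have "(if u = v then ?c else arrs t ''color'' u) \<noteq> (if w = v then ?c else arrs t ''color'' w)"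
            if "u < Suc v" "w < Suc v" "{u, w} \<in> edges G" for u w
            using that old(2) new[of u] new[of w] noself
            by (auto simp: nbrs_def less_Suc_eq insert_commute)
          then show ?case using t2 t1 vm us v c old(1) by (auto simp: less_Suc_eq)
        next
          case 2 then show ?case using t2 t1 vm v by simp
        next
          case 3 then show ?case using t2 t1 vm v f by (simp add: v_def[symmetric] algebra_simps)
        next
          case 4 then show ?case using f by simp
        qed
      qed (use M cM fin t1 v f in auto)
    qed (use 4 v f in \<open>auto simp: v_def\<close>)
  next
    case (5 t)
    then have "vars t ''v'' = N" by simp
    moreover have "u < N \<and> w < N" if "{u, w} \<in> edges G" for u w
      using nbrs_less[OF G, of u w] nbrs_less[OF G, of w u] that by (auto simp: nbrs_def insert_commute)
    ultimately show ?case using 5 unfolding proper_coloring_def by auto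
  next
    case 6 then show ?case by simp
  qed
qed

end

subsection \<open>Random order and random colours\<close>

lemma bij_betw_swap_remove:
  assumes p: "bij_betw p {..<Suc m} U" and r: "r < Suc m"
  shows "bij_betw (p(r := p m)) {..<m} (U - {p r})"
proof -
  let ?q = "p(r := p m)"
  have inj: "p x = p y \<longleftrightarrow> x = y" if "x < Suc m" "y < Suc m" for x y
    using p that by (auto simp: bij_betw_def inj_on_def)
  have U: "U = p ` {..<Suc m}" using p by (auto simp: bij_betw_def)
  have "inj_on ?q {..<m}"
    using r by (intro inj_onI) (auto simp: inj split: if_splits)
  moreover have "?q ` {..<m} = U - {p r}"
  proof (intro equalityI subsetI)
    fix x assume "x \<in> ?q ` {..<m}"
    then show "x \<in> U - {p r}"
      using r by (auto simp: U inj split: if_splits)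
  next
    fix x assume "x \<in> U - {p r}"
    then obtain j where j: "j < Suc m" "x = p j" "j \<noteq> r" by (auto simp: U)
    show "x \<in> ?q ` {..<m}"
    proof (cases "j = m")
      case True
      then show ?thesis using j r by (intro image_eqI[of _ _ r]) auto
    next
      case False
      then show ?thesis using j by (intro image_eqI[of _ _ j]) auto
    qed
  qed
  ultimately show ?thesis by (simp add: bij_betw_def)
qed

context colouring_ram
begin

text \<open>One coloured endpoint is enough in the edge condition: if the other one is uncoloured,
  the values differ anyway.\<close>

definition partial_colouring :: "(nat \<Rightarrow> nat) \<Rightarrow> bool" where
  "partial_colouring col \<longleftrightarrow> (\<forall>v<N. col v \<le> D + 1) \<and>
     (\<forall>u w. {u, w} \<in> edges G \<longrightarrow> col u \<noteq> 0 \<longrightarrow> col u \<noteq> col w)"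

definition uncoloured :: "(nat \<Rightarrow> nat) \<Rightarrow> nat set" where
  "uncoloured col = {u. u < N \<and> col u = 0}"

text \<open>
  Entries \<open>c * N, \<dots>, c * N + cnt c - 1\<close> of \<open>cls\<close> list the vertices of colour \<open>c + 1\<close>.
\<close>

definition classes :: "(nat \<Rightarrow> nat) \<Rightarrow> (nat \<Rightarrow> nat) \<Rightarrow> (nat \<Rightarrow> nat) \<Rightarrow> nat \<Rightarrow> bool" where
  "classes col cnt cls m \<longleftrightarrow>
     (\<forall>c\<le>D. (\<lambda>j. cls (c * N + j)) ` {..<cnt c} = {u. u < N \<and> col u = Suc c}) \<and>
     (\<Sum>c<Suc D. cnt c) + m = N"

lemma class_index_mod:
  assumes "c \<le> D" "j \<le> N"
  shows "(c * N mod W + j) mod W = c * N + j"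
proof -
  have "c * N \<le> N * N" using assms D_le by (intro mult_right_mono) auto
  moreover have "(N + 2) * (N + 2) = N * N + 4 * N + 4" by (simp add: algebra_simps)
  ultimately have "c * N + j < (N + 2) * (N + 2)" using assms(2) by linarith
  from less_W[OF this] show ?thesis by simp
qed

text \<open>\<open>m\<close> counts the uncoloured vertices, and the class lengths sum to
  \<open>N - m\<close>; so each class fits into its block of \<open>N\<close> entries.\<close>

lemma classes_cnt_le: "classes col cnt cls m \<Longrightarrow> c \<le> D \<Longrightarrow> cnt c + m \<le> N"
  using member_le_sum[of c "{..<Suc D}" cnt] unfolding classes_def by auto

lemma classes_insert:
  assumes cl: "classes col cnt cls (Suc m)" and c: "c \<le> D" and v: "v < N" "col v = 0"
  shows "classes (col(v := Suc c)) (cnt(c := Suc (cnt c))) (cls(c * N + cnt c := v)) m"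
  unfolding classes_def
proof (intro conjI allI impI)
  fix c' assume c': "c' \<le> D"
  have old: "(\<lambda>j. cls (c' * N + j)) ` {..<cnt c'} = {u. u < N \<and> col u = Suc c'}"
    using cl c' by (auto simp: classes_def)
  \<comment> \<open>\<open>v\<close> is still uncoloured, so every class has fewer than
    \<open>N\<close> entries and there is room for one more. Division by \<open>N\<close> then
    recovers the block of an index, and the write cannot hit another class.\<close>
  have lt: "cnt c < N" "cnt c' < N" using classes_cnt_le[OF cl] c c' by fastforce+
  have "c' * N + j \<noteq> c * N + cnt c" if "j < cnt c'" for j
  proof
    assume eq: "c' * N + j = c * N + cnt c"
    then have "(c' * N + j) div N = (c * N + cnt c) div N" by simp
    then have "c' = c" using lt that by simp
    then show False using eq that by simp
  qed
  then have "(\<lambda>j. (cls(c * N + cnt c := v)) (c' * N + j)) ` {..<cnt c'} =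
      (\<lambda>j. cls (c' * N + j)) ` {..<cnt c'}"
    by (intro image_cong) auto
  with old have new: "(\<lambda>j. (cls(c * N + cnt c := v)) (c' * N + j)) ` {..<cnt c'} =
      {u. u < N \<and> col u = Suc c'}" by simp
  show "(\<lambda>j. (cls(c * N + cnt c := v)) (c' * N + j)) ` {..<(cnt(c := Suc (cnt c))) c'} =
      {u. u < N \<and> (col(v := Suc c)) u = Suc c'}"
  proof (cases "c' = c")
    case True
    show ?thesis
      unfolding True fun_upd_same lessThan_Suc image_insert new[unfolded True] using v by auto
  next
    case False
    then have "(cnt(c := Suc (cnt c))) c' = cnt c'" by simp
    then show ?thesis unfolding \<open>(cnt(c := Suc (cnt c))) c' = cnt c'\<close> new using False v by auto
  qed
next
  have "(\<Sum>x<Suc D. (cnt(c := Suc (cnt c))) x) = (\<Sum>x<Suc D. cnt x + (if x = c then 1 else 0))"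
    by (intro sum.cong) auto
  also have "\<dots> = (\<Sum>x<Suc D. cnt x) + 1"
    using c by (simp add: sum.distrib less_Suc_eq_le del: sum.lessThan_Suc)
  finally show "(\<Sum>x<Suc D. (cnt(c := Suc (cnt c))) x) + m = N"
    using cl by (simp add: classes_def del: sum.lessThan_Suc)
qed

lemma partial_colouring_insert:
  assumes "partial_colouring col" "c \<le> D" "\<forall>u \<in> nbrs G v. col u \<noteq> Suc c"
  shows "partial_colouring (col(v := Suc c))"
  using assms not_self_nbr[OF G, of v]
  unfolding partial_colouring_def nbrs_def by (auto simp: insert_commute)

lemma uncoloured_insert: "uncoloured (col(v := Suc c)) = uncoloured col - {v}"
  by (auto simp: uncoloured_def)

section \<open>Conflict test and rejection sampling\<close>

lemma bnd_check:
  assumes n: "vars s ''n'' = N" and v: "vars s ''v'' < N" and i: "vars s ''i'' = 0"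
    and ok: "vars s ''ok'' = 1" and c: "vars s ''c'' = c" "c \<le> D"
    and cl: "classes (arrs s ''color'') (arrs s ''cnt'') (arrs s ''cls'') m"
  shows "bnd W G check_com s
    (\<lambda>s'. (\<forall>x. x \<noteq> ''i'' \<longrightarrow> x \<noteq> ''ok'' \<longrightarrow> vars s' x = vars s x) \<and> arrs s' = arrs s \<and>
      vars s' ''ok'' = (if \<exists>u \<in> nbrs G (vars s ''v''). arrs s ''color'' u = Suc c then 0 else 1))
    (\<lambda>_. 0) (22 * arrs s ''cnt'' c + 5)"
proof -
  define v where "v = vars s ''v''"
  define u where "u j = arrs s ''cls'' (c * N + j)" for j
  have cnt: "arrs s ''cnt'' c \<le> N" using classes_cnt_le[OF cl c(2)] by simp
  have U: "u ` {..<arrs s ''cnt'' c} = {u. u < N \<and> arrs s ''color'' u = Suc c}"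
    using cl c(2) by (simp add: classes_def u_def)
  have final: "(\<exists>j<arrs s ''cnt'' c. {v, u j} \<in> edges G) \<longleftrightarrow>
      (\<exists>u \<in> nbrs G v. arrs s ''color'' u = Suc c)"
  proof -
    have "(\<exists>j<arrs s ''cnt'' c. {v, u j} \<in> edges G) \<longleftrightarrow>
        (\<exists>x \<in> u ` {..<arrs s ''cnt'' c}. {v, x} \<in> edges G)" by auto
    also have "\<dots> \<longleftrightarrow> (\<exists>u \<in> nbrs G v. arrs s ''color'' u = Suc c)"
      unfolding U using nbrs_less[OF G] by (auto simp: nbrs_def insert_commute)
    finally show ?thesis .
  qed
  let ?ok = "\<lambda>k. if \<exists>j<k. {v, u j} \<in> edges G then 0 else 1 :: nat"
  let ?I = "\<lambda>s'. (\<forall>x. x \<noteq> ''i'' \<longrightarrow> x \<noteq> ''ok'' \<longrightarrow> vars s' x = vars s x) \<and> arrs s' = arrs s \<and>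
      vars s' ''i'' \<le> arrs s ''cnt'' c \<and> vars s' ''ok'' = ?ok (vars s' ''i'')"
  let ?f = "\<lambda>s'. 22 * (real (arrs s ''cnt'' c) - real (vars s' ''i'')) + 5"
  show ?thesis
    unfolding check_com_def
  proof (rule bnd_While[where I="?I" and f="?f"], goal_cases)
    case (4 t)
    let ?i = "vars t ''i''"
    have t: "vars t ''n'' = N" "vars t ''v'' = v" "vars t ''c'' = c" "arrs t = arrs s"
      "\<And>x. x \<noteq> ''i'' \<Longrightarrow> x \<noteq> ''ok'' \<Longrightarrow> vars t x = vars s x" "vars t ''ok'' = ?ok ?i"
      using 4(1) n c by (auto simp: v_def)
    have il: "?i < arrs s ''cnt'' c" using 4(2) t c by simp
    have m: "Suc ?i mod W = Suc ?i" using il cnt by (intro small_mod_W) simp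
    have m2: "(c * N mod W + ?i) mod W = c * N + ?i"
      using c il cnt by (intro class_index_mod) auto
    have b: "bval W G (Eq (Adj (Var ''v'')
              (Read ''cls'' (Plus (Times (Var ''c'') (Var ''n'')) (Var ''i'')))) (Const 1)) t
        \<longleftrightarrow> {v, u ?i} \<in> edges G"
      using m2 by (simp add: t(1-4) u_def)
    have inc: "bnd W G (incr ''i'') t' ?I ?f (22 * (real (arrs s ''cnt'' c) - real ?i) - 13)"
      if "arrs t' = arrs s" "\<And>x. x \<noteq> ''ok'' \<Longrightarrow> vars t' x = vars t x"
        "vars t' ''ok'' = ?ok (Suc ?i)" for t'
      by (rule bnd_Assign[OF refl]) (use that il m t(5) in auto)
    show ?case
    proof (rule bnd_Seq[where R="\<lambda>t'. arrs t' = arrs s \<and> (\<forall>x. x \<noteq> ''ok'' \<longrightarrow> vars t' x = vars t x) \<and>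
        vars t' ''ok'' = ?ok (Suc ?i)" and h="\<lambda>_. 22 * (real (arrs s ''cnt'' c) - real ?i) - 13"],
        rule bnd_Cond, goal_cases)
      case 1
      then show ?case unfolding b using t(4) il by (intro bnd_Assign[OF refl]) auto
    next
      case 2
      then have "?ok (Suc ?i) = ?ok ?i" unfolding b by (auto simp: less_Suc_eq)
      then show ?case using t(4,6) il by (intro bnd_Skip) auto
    next
      case 3
      then show ?case using il by simp
    next
      case (4 t')
      then show ?case by (intro inc) auto
    qed
  next
    case (5 t)
    then have "vars t ''i'' = arrs s ''cnt'' c" using c by simp
    then show ?case using 5(1) unfolding v_def[symmetric] final[symmetric] by simp
  qed (use n i ok c in auto)
qed

text \<open>\<open>D + 1\<close> times a bound on the mean cost of one draw: 17 steps of overhead,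
  and 22 for each member of the drawn class, where the class sizes sum to at most
  \<open>N\<close>.\<close>

definition sample_cost :: real where
  "sample_cost = 17 * (real D + 1) + 22 * real N"

text \<open>Geometric waiting time: a draw succeeds with probability
  \<open>card good / (D + 1)\<close> and costs \<open>sample_cost / (D + 1)\<close> on average, so
  the total mean is \<open>sample_cost / card good\<close>. The final 4 is the exit test.\<close>

lemma bnd_sample:
  assumes n: "vars s ''n'' = N" "vars s ''d'' = D" and v: "vars s ''v'' = v" "v < N"
    and ok: "vars s ''ok'' = 0"
    and cl: "classes (arrs s ''color'') (arrs s ''cnt'') (arrs s ''cls'') m"
  shows "bnd W G sample_com s
    (\<lambda>s'. (\<forall>x. x \<notin> {''i'', ''ok'', ''c''} \<longrightarrow> vars s' x = vars s x) \<and> arrs s' = arrs s \<and>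
      vars s' ''c'' \<le> D \<and> (\<forall>u \<in> nbrs G v. arrs s ''color'' u \<noteq> Suc (vars s' ''c'')))
    (\<lambda>_. 0) (sample_cost / (1 + real (D - degree G v)
      + real (card (nbrs G v \<inter> uncoloured (arrs s ''color'')))) + 4)"
proof -
  define good where "good = {c. c < D + 1 \<and> (\<forall>u \<in> nbrs G v. arrs s ''color'' u \<noteq> c + 1)}"
  define X where "X = sample_cost / real (card good)"
  have A: "1 + (D - degree G v) + card (nbrs G v \<inter> uncoloured (arrs s ''color'')) \<le> card good"
    using card_free_colours[OF G v(2), of "arrs s ''color''"] by (simp add: good_def uncoloured_def)
  then have A0: "0 < card good" by simp
  have sc: "0 \<le> sample_cost" by (simp add: sample_cost_def)
  have "real (1 + (D - degree G v) + card (nbrs G v \<inter> uncoloured (arrs s ''color''))) \<le> real (card good)"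
    using A by (rule of_nat_mono)
  then have X_le: "X \<le> sample_cost / (1 + real (D - degree G v)
      + real (card (nbrs G v \<inter> uncoloured (arrs s ''color''))))"
    unfolding X_def using sc by (intro divide_left_mono) (auto intro!: mult_pos_pos simp: A0 add_pos_nonneg)
  have X0: "0 \<le> X" using sc by (simp add: X_def)
  have g: "finite good" "good \<subseteq> {..<Suc D}" by (auto simp: good_def)
  let ?I = "\<lambda>s'. (\<forall>x. x \<notin> {''i'', ''ok'', ''c''} \<longrightarrow> vars s' x = vars s x) \<and> arrs s' = arrs s \<and>
      (vars s' ''ok'' \<noteq> 0 \<longrightarrow> vars s' ''c'' \<in> good)"
  let ?f = "\<lambda>s'. (if vars s' ''ok'' = 0 then X else 0) + 4"
  show ?thesis
    unfolding sample_com_def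
  proof (rule bnd_While[where I="?I" and f="?f"], goal_cases)
    case 1 then show ?case using ok by simp
  next
    case 2 then show ?case using ok X_le by simp
  next
    case (3 t) then show ?case using X0 by simp
  next
    case (4 t)
    have t: "\<And>x. x \<notin> {''i'', ''ok'', ''c''} \<Longrightarrow> vars t x = vars s x" "arrs t = arrs s" "vars t ''ok'' = 0"
      using 4 by auto
    \<comment> \<open>After drawing \<open>c\<close>, the two assignments and the last test of the
      scan cost 9. A bad colour restarts the search at cost \<open>X\<close>, and \<open>hX\<close>
      checks that \<open>X\<close> solves the resulting recurrence.\<close>
    define h where "h c = 9 + 22 * real (arrs s ''cnt'' c) + ((if c \<in> good then 0 else X) + 4)" for c
    have hX: "1 + real (acost (Plus (Var ''d'') (Const 1))) + (\<Sum>c<Suc D. h c) / real (Suc D) \<le> X"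
    proof -
      have "(\<Sum>c<Suc D. (if c \<in> good then 0 else X)) = (\<Sum>c\<in>{..<Suc D} - good. X)"
        by (rule sum.mono_neutral_cong_right) auto
      also have "\<dots> = (real (Suc D) - real (card good)) * X"
        using g card_mono[OF _ g(2)] by (simp add: card_Diff_subset of_nat_diff)
      also have "\<dots> = real (Suc D) * X - sample_cost"
        using A0 by (simp add: X_def algebra_simps)
      finally have bad: "(\<Sum>c<Suc D. (if c \<in> good then 0 else X)) = real (Suc D) * X - sample_cost" .
      have "(\<Sum>c<Suc D. h c) = 13 * real (Suc D) + 22 * real (\<Sum>c<Suc D. arrs s ''cnt'' c)
          + (\<Sum>c<Suc D. (if c \<in> good then 0 else X))"
        unfolding h_def by (simp add: sum.distrib sum_distrib_left del: sum.lessThan_Suc)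
      moreover have "(\<Sum>c<Suc D. arrs s ''cnt'' c) \<le> N" using cl by (simp add: classes_def)
      ultimately have "(\<Sum>c<Suc D. h c) \<le> 13 * real (Suc D) + 22 * real N + (real (Suc D) * X - sample_cost)"
        unfolding bad by (simp del: sum.lessThan_Suc of_nat_sum)
      also have "\<dots> = real (Suc D) * (X - 4)" by (simp add: sample_cost_def algebra_simps)
      finally have "(\<Sum>c<Suc D. h c) / real (Suc D) \<le> X - 4"
        by (simp add: divide_le_eq mult.commute del: sum.lessThan_Suc of_nat_Suc)
      then show ?thesis by simp
    qed
    have "bnd W G (Seq (Rand ''c'' (Plus (Var ''d'') (Const 1)))
        (Seq (Assign ''ok'' (Const 1)) (Seq (Assign ''i'' (Const 0)) check_com))) t ?I ?f X"
    proof (rule bnd_Seq_Rand[where m="Suc D" and h=h], goal_cases)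
      case 1 then show ?case using t(1) n D_le by (simp add: small_mod_W)
    next
      case 2 then show ?case by simp
    next
      case (3 c)
      let ?t = "t\<lparr>vars := ((vars t)(''c'' := c, ''ok'' := 1, ''i'' := 0))\<rparr>"
      have c: "c \<le> D" using 3 by simp
      have gd: "c \<in> good \<longleftrightarrow> \<not> (\<exists>u\<in>nbrs G v. arrs s ''color'' u = Suc c)"
        using c by (auto simp: good_def)
      have chk: "bnd W G check_com ?t
        (\<lambda>s'. (\<forall>x. x \<noteq> ''i'' \<longrightarrow> x \<noteq> ''ok'' \<longrightarrow> vars s' x = vars ?t x) \<and> arrs s' = arrs s \<and>
          vars s' ''ok'' = (if c \<in> good then 1 else 0)) (\<lambda>_. 0) (22 * arrs s ''cnt'' c + 5)"
        by (rule bnd_conseq[OF bnd_check[of ?t c m]]) (use t(1,2) n v c cl gd in auto)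
      show ?case
      proof (rule bnd_Seq_Assign[OF refl], rule bnd_Seq_Assign[OF refl], goal_cases)
        case 1
        have "bnd W G check_com ?t ?I ?f (22 * real (arrs s ''cnt'' c) + 5 + ((if c \<in> good then 0 else X) + 4))"
          by (rule bnd_conseq[OF bnd_add_const[OF chk, of "(if c \<in> good then 0 else X) + 4"]])
            (use X0 t(1) in auto)
        then show ?case by (simp add: h_def fun_upd_twist)
      qed (use X0 in \<open>auto simp: h_def\<close>)
    next
      case (4 c) then show ?case using X0 by (simp add: h_def)
    next
      case 5 then show ?case using hX .
    qed
    then show ?case using t(3) by simp
  next
    case (5 t)
    then show ?case by (auto simp: good_def)
  qed
qed

lemma bnd_init_perm:
  assumes "vars s ''n'' = N" "vars s ''i'' = 0"
  shows "bnd W G init_perm_com s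
    (\<lambda>s'. (\<forall>x. x \<noteq> ''i'' \<longrightarrow> vars s' x = vars s x) \<and>
      (\<forall>a. a \<noteq> ''p'' \<longrightarrow> arrs s' a = arrs s a) \<and> (\<forall>j<N. arrs s' ''p'' j = j))
    (\<lambda>_. 0) (11 * N + 4)"
  unfolding init_perm_com_def
proof (rule bnd_While[where I="\<lambda>s'. (\<forall>x. x \<noteq> ''i'' \<longrightarrow> vars s' x = vars s x) \<and>
      (\<forall>a. a \<noteq> ''p'' \<longrightarrow> arrs s' a = arrs s a) \<and> vars s' ''i'' \<le> N \<and>
      (\<forall>j<vars s' ''i''. arrs s' ''p'' j = j)"
      and f="\<lambda>s'. 11 * (real N - real (vars s' ''i'')) + 4"], goal_cases)
  case (4 t)
  then have "vars t ''i'' < N" using assms by simp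
  then show ?case
    by (intro bnd_Seq_Store[OF refl] bnd_Assign[OF refl])
      (use 4 in \<open>auto simp: small_mod_W less_Suc_eq\<close>)
qed (use assms in auto)

text \<open>Each vertex pays a fixed 42 plus its sampling cost, and
  \<open>potential_remove_random\<close> shows that the decrease of the scaled potential pays
  exactly for the mean of the latter.\<close>

lemma bnd_random:
  assumes n: "vars s ''n'' = N" "vars s ''d'' = D"
    and zero: "arrs s ''color'' = (\<lambda>_. 0)" "arrs s ''cnt'' = (\<lambda>_. 0)"
  shows "bnd W G random_com s (\<lambda>s'. proper_coloring G (D + 1) (arrs s' ''color'')) (\<lambda>_. 0)
    (53 * real N + sample_cost * potential G {..<N} + 12)"
proof -
  let ?I = "\<lambda>s'. vars s' ''n'' = N \<and> vars s' ''d'' = D \<and> partial_colouring (arrs s' ''color'') \<and>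
      bij_betw (arrs s' ''p'') {..<vars s' ''m''} (uncoloured (arrs s' ''color'')) \<and>
      classes (arrs s' ''color'') (arrs s' ''cnt'') (arrs s' ''cls'') (vars s' ''m'')"
  let ?f = "\<lambda>s'. 42 * real (vars s' ''m'') +
      sample_cost * potential G (uncoloured (arrs s' ''color'')) + 4"
  have sc: "0 \<le> sample_cost" by (simp add: sample_cost_def)
  have nonneg: "0 \<le> sample_cost * potential G U" for U
    using sc potential_nonneg by simp
  show ?thesis
    unfolding random_com_def
  proof (rule bnd_Seq_Assign[OF refl], rule bnd_Seq_const[OF bnd_init_perm], goal_cases)
    case (5 s1)
    have s1: "vars s1 ''n'' = N" "vars s1 ''d'' = D" "arrs s1 ''color'' = (\<lambda>_. 0)"
      "arrs s1 ''cnt'' = (\<lambda>_. 0)" "\<forall>j<N. arrs s1 ''p'' j = j"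
      using 5 n zero by auto
    have U0: "uncoloured (\<lambda>_. 0) = {..<N}" by (auto simp: uncoloured_def)
    show ?case
    proof (rule bnd_Seq_Assign[OF refl], rule bnd_While[where I="?I" and f="?f"], goal_cases)
      case 1
      have "bij_betw (arrs s1 ''p'') {..<N} {..<N}"
        using s1(5) bij_betw_cong[of "{..<N}" "arrs s1 ''p''" id "{..<N}"] by auto
      then show ?case using s1 by (simp add: U0 partial_colouring_def classes_def)
    next
      case 2 then show ?case using s1 by (simp add: U0)
    next
      case (3 t) then show ?case using nonneg by simp
    next
      case (4 t)
      define m where "m = vars t ''m'' - 1"
      define col where "col = arrs t ''color''"
      define U where "U = uncoloured col"
      define p where "p = arrs t ''p''"
      have tm: "vars t ''m'' = Suc m" using 4 by (simp add: m_def)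
      have t: "vars t ''n'' = N" "vars t ''d'' = D" "partial_colouring col" "bij_betw p {..<Suc m} U"
        "classes col (arrs t ''cnt'') (arrs t ''cls'') (Suc m)"
        using 4(1) by (simp_all add: col_def U_def p_def tm)
      have finU: "finite U" by (auto simp: U_def uncoloured_def)
      have cU: "card U = Suc m" using bij_betw_same_card[OF t(4)] by simp
      define w where "w v = 1 / (1 + real (D - degree G v) + real (card (nbrs G v \<inter> U)))
          + potential G (U - {v})" for v
      have w0: "0 \<le> w v" for v unfolding w_def using potential_nonneg by (intro add_nonneg_nonneg) auto
      \<comment> \<open>The array enumerates \<open>U\<close> bijectively, so a uniform index is a
        uniform uncoloured vertex.\<close>
      have sum_w: "(\<Sum>r<Suc m. w (p r)) = real (Suc m) * potential G U"
      proof -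
        have "(\<Sum>r<Suc m. w (p r)) = (\<Sum>v\<in>U. w v)" by (rule sum.reindex_bij_betw[OF t(4)])
        also have "\<dots> = real (card U) * potential G U"
          unfolding w_def by (rule potential_remove_random[OF G finU])
        finally show ?thesis unfolding cU .
      qed
      define h where "h r = 40 + 42 * real m + sample_cost * w (p r)" for r
      have "(\<Sum>r<Suc m. h r) / real (Suc m) = 40 + 42 * real m + sample_cost * potential G U"
      proof -
        have "(\<Sum>r<Suc m. h r) = real (Suc m) * (40 + 42 * real m) + sample_cost * (\<Sum>r<Suc m. w (p r))"
          unfolding h_def sum.distrib sum_distrib_left by (simp add: algebra_simps)
        also have "\<dots> = real (Suc m) * (40 + 42 * real m + sample_cost * potential G U)"
          unfolding sum_w by (simp only: algebra_simps)
        finally show ?thesis by simp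
      qed
      then have hx: "1 + real (acost (Var ''m'')) + (\<Sum>r<Suc m. h r) / real (Suc m) \<le>
          ?f t - (1 + real (bcost (Less (Const 0) (Var ''m''))))"
        by (simp add: tm col_def[symmetric] U_def)
      show ?case
      proof (rule bnd_Seq_Rand[where m="Suc m" and h=h], goal_cases)
        case 1 then show ?case using tm by simp
      next
        case 2 then show ?case by simp
      next
        case 4 then show ?case using w0 sc by (simp add: h_def)
      next
        case 5 then show ?case using hx .
      next
        case (3 r)
        define v where "v = p r"
        have vU: "v \<in> U" using t(4) 3 by (auto simp: v_def bij_betw_def)
        then have v: "v < N" "col v = 0" by (auto simp: U_def uncoloured_def)
        have bij: "bij_betw (p(r := p m)) {..<m} (U - {v})"
          using bij_betw_swap_remove[OF t(4) 3] by (simp add: v_def)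
        let ?t = "t\<lparr>vars := (vars t)(''r'' := r, ''v'' := v, ''m'' := m, ''ok'' := 0),
          arrs := (arrs t)(''p'' := p(r := p m))\<rparr>"
        define y where "y = sample_cost / (1 + real (D - degree G v) + real (card (nbrs G v \<inter> U))) + 4"
        have y0: "0 \<le> y" unfolding y_def using sc by (intro add_nonneg_nonneg divide_nonneg_nonneg) auto
        have hr: "h r = 27 + 9 + 42 * real m + y + sample_cost * potential G (U - {v})"
          unfolding h_def w_def y_def v_def[symmetric] by (simp add: distrib_left)
        have rest: "bnd W G (Seq (Store ''color'' (Var ''v'') (Plus (Var ''c'') (Const 1)))
            (Seq (Store ''cls'' (Plus (Times (Var ''c'') (Var ''n'')) (Read ''cnt'' (Var ''c''))) (Var ''v''))
            (Store ''cnt'' (Var ''c'') (Plus (Read ''cnt'' (Var ''c'')) (Const 1))))) t' ?I ?f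
            (19 + 42 * real m + sample_cost * potential G (U - {v}) + 4)"
          if t': "\<forall>x. x \<notin> {''i'', ''ok'', ''c''} \<longrightarrow> vars t' x = vars ?t x" "arrs t' = arrs ?t"
            "vars t' ''c'' = c" "c \<le> D" "\<forall>u \<in> nbrs G v. col u \<noteq> Suc c" for t' c
        proof -
          have v': "vars t' ''n'' = N" "vars t' ''d'' = D" "vars t' ''m'' = m" "vars t' ''v'' = v"
            "arrs t' ''color'' = col" "arrs t' ''p'' = p(r := p m)" "arrs t' ''cnt'' = arrs t ''cnt''"
            "arrs t' ''cls'' = arrs t ''cls''"
            using t'(1,2) t by (simp_all add: col_def)
          have cN: "arrs t ''cnt'' c < N" using classes_cnt_le[OF t(5) t'(4)] by simp
          have cm: "Suc c mod W = Suc c" "Suc (arrs t ''cnt'' c) mod W = Suc (arrs t ''cnt'' c)"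
            using t'(4) D_le cN by (auto intro!: small_mod_W)
          have m2: "(c * N mod W + arrs t ''cnt'' c) mod W = c * N + arrs t ''cnt'' c"
            using t'(4) cN by (intro class_index_mod) auto
          show ?thesis
            apply (rule bnd_Seq_Store[OF refl])
             apply (rule bnd_Seq_Store[OF refl])
              apply (rule bnd_Store[OF refl])
            using v' t'(3) cm m2 classes_insert[OF t(5) t'(4) v] bij nonneg[of "U - {v}"]
              partial_colouring_insert[OF t(3) t'(4,5)]
            by (simp_all add: uncoloured_insert flip: U_def)
        qed
        show ?case
        proof (rule bnd_Seq_Assign[OF refl], rule bnd_Seq_Assign[OF refl], rule bnd_Seq_Store[OF refl],
            rule bnd_Seq_Assign[OF refl], goal_cases)
          case 1
          have eq: "X = ?t \<Longrightarrow> bnd W G q ?t Q g z \<Longrightarrow> bnd W G q X Q g z" for X q Q g z by simp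
          show ?case
          proof (rule eq, goal_cases)
            case 1 then show ?case using tm by (simp add: p_def v_def fun_upd_twist)
          next
            case 2
            show ?case
            proof (rule bnd_Seq_const[OF bnd_sample[where v=v and m="Suc m"]], goal_cases)
              case 6 then show ?case using t(5) by (simp add: col_def)
            next
              case (9 t')
              then show ?case
                by (intro bnd_conseq[OF rest[of t' "vars t' ''c''"]])
                  (auto simp: hr y_def col_def U_def)
            qed (use t v y0 nonneg[of "U - {v}"] in \<open>auto simp: hr y_def col_def U_def\<close>)
          qed
        qed (use y0 nonneg[of "U - {v}"] in \<open>auto simp: hr\<close>)
      qed
    next
      case (5 t)
      then have "uncoloured (arrs t ''color'') = {}" by (auto simp: bij_betw_def)
      then have pos: "\<forall>v<N. arrs t ''color'' v \<noteq> 0" by (auto simp: uncoloured_def)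
      have "u < N" if "{u, w} \<in> edges G" for u w
        using nbrs_less[OF G, of u w] that by (auto simp: nbrs_def)
      then show ?case
        using 5(1) pos nonneg unfolding proper_coloring_def partial_colouring_def
        by (auto simp: Suc_le_eq)
    next
      case 6 then show ?case using nonneg[of "{..<N}"] by simp
    qed
  qed (use n nonneg[of "{..<N}"] in auto)
qed

end

subsection \<open>The time bound\<close>

text \<open>The slope 81 is \<open>16 + 12 + 53\<close> from the two preliminary loops and the
  random branch, and 32 is \<open>4 + 8 + 8 + 12\<close>, including the branch test. The factor 39
  is \<open>17 + 22\<close> from \<open>sample_cost\<close>.\<close>

definition time_bound :: "nat \<Rightarrow> real" where
  "time_bound n = 81 * real n + 32 + 39 * (real n * sqrt (real n * (ln (real n) / ln 2 + 2)))"

lemma time_bound_bigo: "time_bound \<in> O(\<lambda>n. real n * sqrt (real n * ln (real n)))"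
  unfolding time_bound_def by real_asymp

text \<open>\<open>L\<close> bits already reach \<open>n + 2\<close>; twice as many bits square the
  range.\<close>

lemma word_count_2_ge: "(n + 2) ^ 2 \<le> word_count 2 n"
proof -
  define L where "L = nat \<lceil>log 2 (real n + 2)\<rceil>"
  have "real n + 2 = 2 powr (log 2 (real n + 2))" by simp
  also have "\<dots> \<le> 2 powr real L"
    unfolding L_def by (intro powr_mono real_nat_ceiling_ge) auto
  also have "\<dots> = real (2 ^ L)" by (simp add: powr_realpow)
  finally have "n + 2 \<le> 2 ^ L" by linarith
  then have "(n + 2) ^ 2 \<le> (2 ^ L) ^ 2" by (rule power_mono) simp
  also have "(2 ^ L) ^ 2 = word_count 2 n"
    unfolding word_count_def L_def[symmetric] by (subst mult.commute) (rule power_mult[symmetric])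
  finally show ?thesis .
qed

context colouring_ram
begin

text \<open>With \<open>r = sqrt (N * (k + 1)) \<le> D\<close>, the potential is at most
  \<open>N * (k + 1) / (D + 1) = r * r / (D + 1) \<le> r\<close>.\<close>

lemma sample_cost_potential_le:
  assumes k: "N \<le> 2 ^ k" and d: "N * Suc k \<le> D * D"
  shows "sample_cost * potential G {..<N} \<le> 39 * (real N * sqrt (real (N * Suc k)))"
proof (cases "N = 0")
  case True
  then show ?thesis by (simp add: potential_def)
next
  case False
  then have DN: "D + 1 \<le> N" using max_degree_less_nverts[OF G] by simp
  have "harm (D + 1) \<le> (harm (2 ^ k) :: real)" using DN k by (intro harm_mono) simp
  also have "\<dots> \<le> real (Suc k)" using harm_power2_le[of k] by simp
  finally have H: "harm (D + 1) \<le> real (Suc k)" .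
  have "sqrt (real (N * Suc k)) \<le> sqrt (real (D * D))"
    using d by (intro real_sqrt_le_mono of_nat_mono)
  then have r: "sqrt (real (N * Suc k)) \<le> real (D + 1)" by simp
  have "real N * (harm (D + 1) / real (D + 1)) \<le> real N * (real (Suc k) / real (D + 1))"
    using H by (intro mult_left_mono divide_right_mono) auto
  also have "\<dots> = sqrt (real (N * Suc k)) * sqrt (real (N * Suc k)) / real (D + 1)"
    unfolding real_sqrt_mult_self by (simp del: of_nat_Suc mult_Suc_right)
  also have "\<dots> \<le> sqrt (real (N * Suc k)) * real (D + 1) / real (D + 1)"
    using r by (intro divide_right_mono mult_left_mono) auto
  also have "\<dots> = sqrt (real (N * Suc k))" by simp
  finally have "potential G {..<N} \<le> sqrt (real (N * Suc k))"
    using potential_le_harm[OF G] by simp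
  moreover have "sample_cost \<le> 39 * real N" using DN unfolding sample_cost_def by simp
  ultimately have "sample_cost * potential G {..<N} \<le> (39 * real N) * sqrt (real (N * Suc k))"
    using potential_nonneg by (intro mult_mono) auto
  then show ?thesis by simp
qed

lemma greedy_cost_le:
  assumes "D * D < N * Suc k"
  shows "real N * real D \<le> real N * sqrt (real (N * Suc k))"
proof -
  have "sqrt (real (D * D)) \<le> sqrt (real (N * Suc k))"
    using assms by (intro real_sqrt_le_mono of_nat_mono) simp
  then show ?thesis by (intro mult_left_mono) auto
qed

text \<open>Minimality of \<open>k\<close> gives \<open>k - 1 \<le> log 2 N\<close>, hence the
  summand 2.\<close>

lemma root_term_le:
  assumes "k = 0 \<or> 2 ^ (k - 1) < N"
  shows "real N * sqrt (real (N * Suc k)) \<le> real N * sqrt (real N * (ln (real N) / ln 2 + 2))"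
proof (cases "N = 0")
  case False
  have "real (Suc k) \<le> ln (real N) / ln 2 + 2"
  proof (cases "k = 0")
    case True
    have "0 \<le> ln (real N)" using False by simp
    then show ?thesis using True by simp
  next
    case nz: False
    have "real (2 ^ (k - 1)) \<le> real N" using assms nz by (intro of_nat_mono) simp
    then have lt: "2 ^ (k - 1) \<le> real N" by simp
    have "real (k - 1) = log 2 (2 ^ (k - 1))" by simp
    also have "\<dots> \<le> log 2 (real N)" using lt by (intro log_mono) auto
    finally show ?thesis using nz by (simp add: log_def of_nat_diff)
  qed
  then have "real N * real (Suc k) \<le> real N * (ln (real N) / ln 2 + 2)"
    by (intro mult_left_mono) auto
  then show ?thesis
    by (intro mult_left_mono real_sqrt_le_mono) (simp_all del: of_nat_Suc mult_Suc_right)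
qed simp

lemma bnd_colouring:
  "bnd W G colouring_com (init_state G) (\<lambda>s. proper_coloring G (D + 1) (arrs s ''color''))
    (\<lambda>_. 0) (time_bound N)"
proof -
  let ?R = "real N * sqrt (real N * (ln (real N) / ln 2 + 2))"
  have T: "time_bound N = 81 * real N + 32 + 39 * ?R" by (simp add: time_bound_def)
  have R0: "0 \<le> ?R"
  proof (cases "N = 0")
    case False
    then have "0 \<le> ln (real N)" by simp
    then show ?thesis by (intro mult_nonneg_nonneg real_sqrt_ge_zero add_nonneg_nonneg) auto
  qed simp
  show ?thesis
    unfolding colouring_com_def
  proof (rule bnd_Seq_const[OF bnd_max_degree], goal_cases)
    case (6 s1)
    have s1: "arrs s1 = (\<lambda>_ _. 0)" "vars s1 ''n'' = N" "vars s1 ''d'' = D"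
      using 6 by (auto simp: init_state_def)
    show ?case
    proof (rule bnd_Seq_const[OF bnd_log], goal_cases)
      case (4 s2)
      then obtain k where k: "vars s2 ''l'' = Suc k" "N \<le> 2 ^ k" "k = 0 \<or> 2 ^ (k - 1) < N"
        by auto
      have s2: "arrs s2 = (\<lambda>_ _. 0)" "vars s2 ''n'' = N" "vars s2 ''d'' = D"
        using 4 s1 by auto
      \<comment> \<open>Both products in the branch test must be below \<open>W\<close>, so that the
        machine compares the true values.\<close>
      have "Suc k \<le> N + 1"
      proof (cases "k = 0")
        case False
        have "k - 1 < 2 ^ (k - 1)" by (rule less_exp)
        then show ?thesis using k(3) False by linarith
      qed simp
      then have "N * Suc k \<le> N * (N + 1)" by (rule mult_left_mono) simp
      also have "N * (N + 1) < (N + 2) * (N + 2)" by (intro mult_strict_mono) auto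
      finally have "N * Suc k < (N + 2) * (N + 2)" .
      moreover have "D * D < (N + 2) * (N + 2)" using D_le by (intro mult_strict_mono) auto
      ultimately have m: "N * Suc k mod W = N * Suc k" "D * D mod W = D * D"
        using less_W by auto
      have b: "bval W G (Less (Times (Var ''d'') (Var ''d'')) (Times (Var ''n'') (Var ''l''))) s2
          \<longleftrightarrow> D * D < N * Suc k"
        using m by (simp add: s2 k(1) del: mult_Suc_right)
      note R = root_term_le[OF k(3)]
      show ?case
      proof (rule bnd_Cond, goal_cases)
        case 1
        then have d: "D * D < N * Suc k" unfolding b .
        have "real (28 * N * (D + 1) + 6) = 28 * (real N * real D) + 28 * real N + 6"
          by (simp add: distrib_left)
        \<comment> \<open>The budget left at this point is sized for the random branch; the greedy
          cost fits since \<open>28 \<le> 39\<close> and \<open>28 \<le> 53\<close>.\<close>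
        also have "\<dots> \<le> 53 * real N + 12 + 39 * ?R"
          using order_trans[OF greedy_cost_le[OF d] R] R0 by linarith
        finally have "real (28 * N * (D + 1) + 6) \<le> 53 * real N + 12 + 39 * ?R" .
        then show ?case
          by (intro bnd_conseq[OF bnd_greedy]) (use s2 in \<open>simp_all add: T\<close>)
      next
        case 2
        then have d: "N * Suc k \<le> D * D" unfolding b by simp
        have "53 * real N + sample_cost * potential G {..<N} + 12 \<le> 53 * real N + 12 + 39 * ?R"
          using sample_cost_potential_le[OF k(2) d] R by linarith
        then show ?case
          by (intro bnd_conseq[OF bnd_random]) (use s2 in \<open>simp_all add: T\<close>)
      next
        case 3
        then show ?case using R0 by (simp add: T)
      qed
    qed (use s1 R0 in \<open>auto simp: T\<close>)
  qed (use R0 in \<open>auto simp: init_state_def T\<close>)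
qed

end

theorem theoremA1:
  shows "\<exists>(P :: com) (k :: nat) (T :: nat \<Rightarrow> real).
    0 < k \<and>
    T \<in> O(\<lambda>n. real n * sqrt (real n * ln (real n))) \<and>
    (\<forall>G :: graph. valid_graph G \<longrightarrow>
       lossless_spmf (run k P G) \<and>
       (\<forall>(col, t) \<in> set_spmf (run k P G). proper_coloring G (max_degree G + 1) col) \<and>
       expected_time k P G \<le> ennreal (T (nverts G)))"
proof (intro exI conjI allI impI)
  \<comment> \<open>The witnesses are fixed by the goals shown: word factor 2 here, then
    \<open>time_bound\<close>, and finally \<open>colouring_com\<close>.\<close>
  show "(0::nat) < 2" by simp
  show "time_bound \<in> O(\<lambda>n. real n * sqrt (real n * ln (real n)))"
    by (rule time_bound_bigo)
next
  fix G assume "valid_graph G"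
  then interpret colouring_ram "word_count 2 (nverts G)" G
    using word_count_2_ge by unfold_locales
  note * = bnd_run[OF bnd_colouring]
  show "lossless_spmf (run 2 colouring_com G)"
    "\<forall>(col, t) \<in> set_spmf (run 2 colouring_com G). proper_coloring G (max_degree G + 1) col"
    "expected_time 2 colouring_com G \<le> ennreal (time_bound (nverts G))"
    by (fact *)+
qed

end
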